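(* Let $\chi\in[0,1]$ and consider the modified boundary conditions $$[\hat\chi M_o^T,\ M_o^TS^{-1}M_o]\,(W-b)=0$$ together with the no-mass-flow condition $u_2=0$ (i.e. $w_{\boldsymbol e_2}=0$), where all objects are defined in the context. These boundary conditions are maximal positive, namely: (i) If $\boldsymbol u^w=0$ and $\theta^w=0$, the boundary conditions determine a linear space $$V=\left\{v\in\mathbb{R}^N:\ v_{\boldsymbol e_2}=0\ \text{and there is } \rho^w\in\mathbb{R}\text{ with }[\hat\chi M_o^T,\ M_o^TS^{-1}M_o](v-b)=0,\ b_{\boldsymbol 0}=\rho^w,\ b_{\boldsymbol\alpha}=0\ (\boldsymbol\alpha\neq\boldsymbol 0)\right\}$$ with $\dim V=m$, where $m$ is the number of nonnegative eigenvalues of $-A_2$ counted with multiplicity. (ii) For every $v\in V$, $\;-v^TA_2v\ge0$.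
   Context: Fix a positive integer $M$ (the moment order). Let $\mathbb{I}_e$ (resp. $\mathbb{I}_o$) be the set of multi-indices $\boldsymbol\alpha=(\alpha_1,\alpha_2,\alpha_3)\in\mathbb{N}^3$ with $|\boldsymbol\alpha|=\alpha_1+\alpha_2+\alpha_3\le M$ and $\alpha_2$ even (resp. odd). Let $m=\#\mathbb{I}_e$, $n=\#\mathbb{I}_o$, $N=m+n$. Vectors $W\in\mathbb{R}^N$ have components $w_{\boldsymbol\alpha}$ indexed by $|\boldsymbol\alpha|\le M$, with all indices in $\mathbb{I}_e$ placed before those in $\mathbb{I}_o$; within each of the two groups indices are ordered by increasing $|\boldsymbol\alpha|$ and, for equal $|\boldsymbol\alpha|$, $\boldsymbol\alpha$ precedes $\boldsymbol\beta$ if $\alpha_i>\beta_i$ at the first position $i$ where they differ. $\boldsymbol e_i$ denotes the $i$-th standard basis vector of $\mathbb{N}^3$. The macroscopic quantities include $\rho=w_{\boldsymbol 0}$, $u_i=w_{\boldsymbol e_i}$. Let $\mathcal{M}(\boldsymbol\xi)=(2\pi)^{-3/2}\exp(-|\boldsymbol\xi|^2/2)$ on $\mathbb{R}^3$, let $\phi_{\boldsymbol\alpha}$ be the Hermite polynomials with $\phi_{\boldsymbol 0}=1$, orthonormal with respect to $\mathcal{M}$ (products of one-dimensional normalized Hermite polynomials), and $\langle\cdot\rangle=\int_{\mathbb{R}^3}\cdot\,d\boldsymbol\xi$. Define $M_o\in\mathbb{R}^{m\times n}$ by $M_o[\boldsymbol\alpha,\boldsymbol\beta]=\langle\xi_2\mathcal{M}\phi_{\boldsymbol\alpha}\phi_{\boldsymbol\beta}\rangle=\sqrt{\alpha_2}\,\delta_{\boldsymbol\beta,\boldsymbol\alpha-\boldsymbol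 e_2}+\sqrt{\alpha_2+1}\,\delta_{\boldsymbol\beta,\boldsymbol\alpha+\boldsymbol e_2}$ for $\boldsymbol\alpha\in\mathbb{I}_e,\boldsymbol\beta\in\mathbb{I}_o$, and the symmetric positive definite matrix $S\in\mathbb{R}^{m\times m}$ by $S[\boldsymbol\alpha,\boldsymbol\beta]=\frac{\sqrt{2\pi}}2\langle|\xi_2|\mathcal{M}\phi_{\boldsymbol\alpha}\phi_{\boldsymbol\beta}\rangle$ for $\boldsymbol\alpha,\boldsymbol\beta\in\mathbb{I}_e$ ($M_o$ has full column rank). Then $$A_2=\begin{bmatrix} 0 & M_o \\ M_o^T & 0 \end{bmatrix}\in\mathbb{R}^{N\times N},\qquad \hat\chi=\frac{2\chi}{(2-\chi)\sqrt{2\pi}}.$$ The vector $b\in\mathbb{R}^N$ has $b_{\boldsymbol 0}=\rho^w$, $b_{\boldsymbol e_i}=u_i^w$, $b_{2\boldsymbol e_i}=\theta^w/\sqrt2$, and all other components zero, where $\boldsymbol u^w=(u_1^w,u_2^w,u_3^w)$ with $u_2^w=0$ and $\theta^w$ are the prescribed wall velocity and temperature, while $\rho^w$ is not prescribed but chosen so that the no-mass-flow condition $u_2=0$ holds. The gas domain is $\{x_2>0\}$ with outward normal $\boldsymbol n=(0,-1,0)$, so the boundary matrix is $-A_2$. *)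

theory Defs
  imports
    "HOL-Analysis.Analysis"
    "Jordan_Normal_Form.Char_Poly"
    "Jordan_Normal_Form.Gauss_Jordan_Elimination"
    "Jordan_Normal_Form.VS_Connect"
begin

unbundle no vec_syntax
unbundle no inner_syntax

section \<open>Multi-indices and their ordering\<close>

type_synonym mindex = "nat \<times> nat \<times> nat"

fun mdeg :: "mindex \<Rightarrow> nat" where
  "mdeg (a1, a2, a3) = a1 + a2 + a3"

definition I_even :: "nat \<Rightarrow> mindex set" where
  "I_even M = {(a1, a2, a3). a1 + a2 + a3 \<le> M \<and> even a2}"

definition I_odd :: "nat \<Rightarrow> mindex set" where
  "I_odd M = {(a1, a2, a3). a1 + a2 + a3 \<le> M \<and> odd a2}"

definition m_dim :: "nat \<Rightarrow> nat" where
  "m_dim M = card (I_even M)"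

definition n_dim :: "nat \<Rightarrow> nat" where
  "n_dim M = card (I_odd M)"

definition N_dim :: "nat \<Rightarrow> nat" where
  "N_dim M = m_dim M + n_dim M"

text \<open>Precedence within each parity class: smaller total degree first; for equal degree, the
  larger entry at the first position of difference comes first.\<close>

fun precedes :: "mindex \<Rightarrow> mindex \<Rightarrow> bool" where
  "precedes (a1, a2, a3) (b1, b2, b3) \<longleftrightarrow>
     mdeg (a1, a2, a3) < mdeg (b1, b2, b3) \<or>
     mdeg (a1, a2, a3) = mdeg (b1, b2, b3) \<and>
       (a1 > b1 \<or> a1 = b1 \<and> (a2 > b2 \<or> a2 = b2 \<and> a3 > b3))"

definition mindex_list :: "nat \<Rightarrow> mindex list" where
  "mindex_list M =
     concat (map (\<lambda>d. concat (map (\<lambda>a1. map (\<lambda>a2. (a1, a2, d - a1 - a2))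
       (rev [0..<Suc (d - a1)])) (rev [0..<Suc d]))) [0..<Suc M])"

definition even_list :: "nat \<Rightarrow> mindex list" where
  "even_list M = filter (\<lambda>(a1, a2, a3). even a2) (mindex_list M)"

definition odd_list :: "nat \<Rightarrow> mindex list" where
  "odd_list M = filter (\<lambda>(a1, a2, a3). odd a2) (mindex_list M)"

definition index_list :: "nat \<Rightarrow> mindex list" where
  "index_list M = even_list M @ odd_list M"

lemma set_mindex_list: "set (mindex_list M) = {(a1, a2, a3). a1 + a2 + a3 \<le> M}"
proof (rule Set.set_eqI)
  fix \<alpha> :: mindex
  obtain a1 a2 a3 where \<alpha>: "\<alpha> = (a1, a2, a3)" by (cases \<alpha>)
  show "\<alpha> \<in> set (mindex_list M) \<longleftrightarrow> \<alpha> \<in> {(a1, a2, a3). a1 + a2 + a3 \<le> M}"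
  proof
    assume "\<alpha> \<in> set (mindex_list M)"
    then show "\<alpha> \<in> {(a1, a2, a3). a1 + a2 + a3 \<le> M}"
      by (auto simp: mindex_list_def \<alpha> simp del: upt_Suc)
  next
    assume "\<alpha> \<in> {(a1, a2, a3). a1 + a2 + a3 \<le> M}"
    then have "a1 + a2 + a3 \<le> M" by (simp add: \<alpha>)
    then show "\<alpha> \<in> set (mindex_list M)"
      by (simp add: mindex_list_def \<alpha> image_iff del: upt_Suc)
        (rule bexI[of _ "a1 + a2 + a3"], auto)
  qed
qed

lemma sorted_wrt_concat_map:
  assumes "sorted_wrt R xs"
    and "\<And>x. x \<in> set xs \<Longrightarrow> sorted_wrt Q (f x)"
    and "\<And>x y u v. x \<in> set xs \<Longrightarrow> y \<in> set xs \<Longrightarrow> R x y \<Longrightarrow> u \<in> set (f x) \<Longrightarrow> v \<in> set (f y) \<Longrightarrow> Q u v"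
  shows "sorted_wrt Q (concat (map f xs))"
  using assms
proof (induction xs)
  case Nil
  show ?case by simp
next
  case (Cons a xs)
  have "sorted_wrt Q (concat (map f xs))"
    by (rule Cons.IH) (use Cons.prems in \<open>simp, simp, meson list.set_intros(2)\<close>)
  moreover have "Q u v" if "u \<in> set (f a)" "y \<in> set xs" "v \<in> set (f y)" for u v y
    by (rule Cons.prems(3)[of a y]) (use that Cons.prems(1) in auto)
  ultimately show ?case
    using Cons.prems(2)[of a] by (auto simp: sorted_wrt_append)
qed

lemma sorted_wrt_rev_upt: "sorted_wrt (>) (rev [i..<j])"
  by (simp add: sorted_wrt_rev)

lemma sorted_mindex_list: "sorted_wrt precedes (mindex_list M)"
  unfolding mindex_list_def
proof (rule sorted_wrt_concat_map[where R = "(<)"], goal_cases)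
  case 1
  show ?case by (simp del: upt_Suc)
next
  case (2 d)
  show ?case
  proof (rule sorted_wrt_concat_map[where R = "(>)"], goal_cases)
    case 1
    show ?case by (rule sorted_wrt_rev_upt)
  next
    case (2 a1)
    have "sorted_wrt (\<lambda>x y. precedes (a1, x, d - a1 - x) (a1, y, d - a1 - y)) (rev [0..<Suc (d - a1)])"
      by (rule sorted_wrt_mono_rel[OF _ sorted_wrt_rev_upt])
        (use 2 in \<open>auto simp del: upt_Suc\<close>)
    then show ?case by (simp add: sorted_wrt_map del: upt_Suc)
  next
    case (3 x y u v)
    then show ?case by (auto simp del: upt_Suc)
  qed
next
  case (3 x y u v)
  then show ?case by (auto simp del: upt_Suc)
qed

lemma distinct_mindex_list: "distinct (mindex_list M)"
proof -
  have "distinct xs" if "sorted_wrt precedes xs" for xs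
    using that by (induction xs) auto
  then show ?thesis using sorted_mindex_list by blast
qed

lemma even_list_props:
  "set (even_list M) = I_even M" "distinct (even_list M)" "sorted_wrt precedes (even_list M)"
  by (auto simp: even_list_def I_even_def set_mindex_list distinct_mindex_list
      intro!: sorted_wrt_filter sorted_mindex_list)

lemma odd_list_props:
  "set (odd_list M) = I_odd M" "distinct (odd_list M)" "sorted_wrt precedes (odd_list M)"
  by (auto simp: odd_list_def I_odd_def set_mindex_list distinct_mindex_list
      intro!: sorted_wrt_filter sorted_mindex_list)

lemma length_index_lists:
  "length (even_list M) = m_dim M" "length (odd_list M) = n_dim M"
  "length (index_list M) = N_dim M"
  using distinct_card[OF even_list_props(2), of M] distinct_card[OF odd_list_props(2), of M]
  by (simp_all add: m_dim_def n_dim_def N_dim_def index_list_def even_list_props odd_list_props)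

lemma distinct_index_list: "distinct (index_list M)"
  by (auto simp: index_list_def even_list_props odd_list_props I_even_def I_odd_def)

definition entry :: "nat \<Rightarrow> real vec \<Rightarrow> mindex \<Rightarrow> real" where
  "entry M v \<alpha> = v $ (THE i. i < N_dim M \<and> index_list M ! i = \<alpha>)"

lemma entry_index_list: "i < N_dim M \<Longrightarrow> entry M v (index_list M ! i) = v $ i"
  unfolding entry_def
  by (rule arg_cong[of _ _ "vec_index v"], rule the_equality)
    (auto simp: nth_eq_iff_index_eq distinct_index_list length_index_lists)

section \<open>Hermite polynomials and the matrices\<close>

text \<open>One-dimensional Hermite polynomials with leading coefficient 1, orthogonal with respect to
  the weight \<open>exp (- x\<^sup>2 / 2)\<close>.\<close>

fun He :: "nat \<Rightarrow> real \<Rightarrow> real" where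
  "He 0 x = 1"
| "He (Suc 0) x = x"
| "He (Suc (Suc k)) x = x * He (Suc k) x - real (Suc k) * He k x"

definition He_normalized :: "nat \<Rightarrow> real \<Rightarrow> real" where
  "He_normalized k x = He k x / sqrt (fact k)"

definition phi :: "mindex \<Rightarrow> real \<times> real \<times> real \<Rightarrow> real" where
  "phi = (\<lambda>(a1, a2, a3) (x1, x2, x3).
     He_normalized a1 x1 * He_normalized a2 x2 * He_normalized a3 x3)"

definition maxwellian :: "real \<times> real \<times> real \<Rightarrow> real" where
  "maxwellian \<xi> = (2 * pi) powr (- 3 / 2) * exp (- (norm \<xi>)\<^sup>2 / 2)"

definition xi2 :: "real \<times> real \<times> real \<Rightarrow> real" where
  "xi2 = (\<lambda>(x1, x2, x3). x2)"

definition Mo_mat :: "nat \<Rightarrow> real mat" where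
  "Mo_mat M = mat (m_dim M) (n_dim M) (\<lambda>(i, j).
     LINT \<xi>|lborel. xi2 \<xi> * maxwellian \<xi> * phi (even_list M ! i) \<xi> * phi (odd_list M ! j) \<xi>)"

definition S_mat :: "nat \<Rightarrow> real mat" where
  "S_mat M = mat (m_dim M) (m_dim M) (\<lambda>(i, j).
     sqrt (2 * pi) / 2 *
     (LINT \<xi>|lborel. \<bar>xi2 \<xi>\<bar> * maxwellian \<xi> * phi (even_list M ! i) \<xi> * phi (even_list M ! j) \<xi>))"

definition S_inv :: "nat \<Rightarrow> real mat" where
  "S_inv M = the (mat_inverse (S_mat M))"

definition A2_mat :: "nat \<Rightarrow> real mat" where
  "A2_mat M = four_block_mat (0\<^sub>m (m_dim M) (m_dim M)) (Mo_mat M)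
     (transpose_mat (Mo_mat M)) (0\<^sub>m (n_dim M) (n_dim M))"

section \<open>Boundary conditions\<close>

definition chi_hat :: "real \<Rightarrow> real" where
  "chi_hat \<chi> = 2 * \<chi> / ((2 - \<chi>) * sqrt (2 * pi))"

text \<open>The lower blocks have no rows, so this is the \<open>n \<times> N\<close> matrix formed by placing the two
  upper blocks side by side.\<close>

definition bc_mat :: "nat \<Rightarrow> real \<Rightarrow> real mat" where
  "bc_mat M \<chi> = four_block_mat
     (chi_hat \<chi> \<cdot>\<^sub>m transpose_mat (Mo_mat M))
     (transpose_mat (Mo_mat M) * S_inv M * Mo_mat M)
     (0\<^sub>m 0 (m_dim M)) (0\<^sub>m 0 (n_dim M))"

fun wall_entry :: "real \<Rightarrow> real \<times> real \<times> real \<Rightarrow> real \<Rightarrow> mindex \<Rightarrow> real" where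
  "wall_entry \<rho>w (u1, u2, u3) \<theta>w \<alpha> =
     (if \<alpha> = (0, 0, 0) then \<rho>w
      else if \<alpha> = (1, 0, 0) then u1
      else if \<alpha> = (0, 1, 0) then u2
      else if \<alpha> = (0, 0, 1) then u3
      else if \<alpha> \<in> {(2, 0, 0), (0, 2, 0), (0, 0, 2)} then \<theta>w / sqrt 2
      else 0)"

definition wall_vec :: "nat \<Rightarrow> real \<Rightarrow> real \<times> real \<times> real \<Rightarrow> real \<Rightarrow> real vec" where
  "wall_vec M \<rho>w uw \<theta>w = vec (N_dim M) (\<lambda>i. wall_entry \<rho>w uw \<theta>w (index_list M ! i))"

text \<open>The vectors admitted by the boundary conditions for given wall velocity and temperature;
  the wall density is not prescribed.\<close>

definition bc_set :: "nat \<Rightarrow> real \<Rightarrow> real \<times> real \<times> real \<Rightarrow> real \<Rightarrow> real vec set" where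
  "bc_set M \<chi> uw \<theta>w = {v \<in> carrier_vec (N_dim M).
     entry M v (0, 1, 0) = 0 \<and>
     (\<exists>\<rho>w. bc_mat M \<chi> *\<^sub>v (v - wall_vec M \<rho>w uw \<theta>w) = 0\<^sub>v (n_dim M))}"

section \<open>Dimension and eigenvalue count\<close>

definition subspace_dim :: "nat \<Rightarrow> real vec set \<Rightarrow> nat" where
  "subspace_dim N W = vectorspace.dim class_ring (module_vec TYPE(real) N\<lparr>carrier := W\<rparr>)"

definition num_nonneg_eigenvalues :: "real mat \<Rightarrow> nat" where
  "num_nonneg_eigenvalues A = (\<Sum>k \<in> {k. eigenvalue A k \<and> 0 \<le> k}. Polynomial.order k (char_poly A))"

end

theory Submission
  imports Defs "HOL-Probability.Distributions"
begin

text \<open>Write \<open>K = M\<^sub>o\<^sup>T S\<^sup>-\<^sup>1 M\<^sub>o\<close>, which is positive definite because \<open>S\<close> is and \<open>M\<^sub>o\<close> is injective. Since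
  \<open>M\<^sub>o\<^sup>T\<close> maps the unit vector at \<open>0\<close> to the unit vector \<open>f\<close> at \<open>e\<^sub>2\<close>, the homogeneous boundary conditions
  for \<open>v = (x, y)\<close> read \<open>c M\<^sub>o\<^sup>T x + K y = c \<rho> f\<close>, \<open>f \<bullet> y = 0\<close>. Pairing with \<open>y\<close> eliminates the free density:
  \<open>c (M\<^sub>o\<^sup>T x) \<bullet> y = - y \<bullet> K y\<close>. This gives the sign of \<open>v \<bullet> A\<^sub>2 v = 2 (M\<^sub>o\<^sup>T x) \<bullet> y\<close>, and it shows that
  \<open>x\<close> determines \<open>y\<close>; conversely every \<open>x\<close> occurs, because \<open>f \<bullet> K\<^sup>-\<^sup>1 f > 0\<close> lets one solve for \<open>\<rho>\<close>. The eigenvalue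
  count follows from \<open>z\<^sup>n det (z - A) = z\<^sup>m det (z\<^sup>2 - M\<^sub>o\<^sup>T M\<^sub>o)\<close> with \<open>A = - A\<^sub>2\<close>, as the \<open>n\<close> roots of the
  characteristic polynomial of \<open>M\<^sub>o\<^sup>T M\<^sub>o\<close> are positive.\<close>

unbundle no vec_syntax
unbundle no inner_syntax

section \<open>Hermite polynomials and the Gaussian weight\<close>

definition gauss_mean :: "real poly \<Rightarrow> real" where
  "gauss_mean p = (LINT x|lborel. std_normal_density x * poly p x)"

lemma integrable_gauss_poly: "integrable lborel (\<lambda>x. std_normal_density x * poly p x)"
proof -
  have "integrable lborel (\<lambda>x. \<Sum>i\<le>degree p. coeff p i * (std_normal_density x * x ^ i))"
    by (intro Bochner_Integration.integrable_sum integrable_mult_right integrable_std_normal_moment)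
  then show ?thesis
    by (simp add: poly_altdef sum_distrib_left mult_ac)
qed

lemma gauss_mean_add: "gauss_mean (p + q) = gauss_mean p + gauss_mean q"
  by (simp add: gauss_mean_def distrib_left integrable_gauss_poly)

lemma gauss_mean_diff: "gauss_mean (p - q) = gauss_mean p - gauss_mean q"
  by (simp add: gauss_mean_def right_diff_distrib integrable_gauss_poly)

lemma gauss_mean_smult: "gauss_mean (Polynomial.smult c p) = c * gauss_mean p"
proof -
  have "gauss_mean (Polynomial.smult c p) = (LINT x|lborel. c * (std_normal_density x * poly p x))"
    by (simp add: gauss_mean_def mult_ac)
  then show ?thesis by (simp add: gauss_mean_def)
qed

lemma gauss_mean_monom_rec:
  "gauss_mean (monom 1 (Suc (Suc n))) = real (Suc n) * gauss_mean (monom 1 n)"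
proof (cases "even n")
  case True
  then obtain k where n: "n = 2 * k" by blast
  have "gauss_mean (monom 1 (2 * j)) = fact (2 * j) / (2 ^ j * fact j)" for j
    using integral_std_normal_moment_even[of j] by (simp add: gauss_mean_def poly_monom)
  from this[of k] this[of "Suc k"]
  have g: "gauss_mean (monom 1 n) = fact (2 * k) / (2 ^ k * fact k)"
    "gauss_mean (monom 1 (Suc (Suc n))) = fact (2 * Suc k) / (2 ^ Suc k * fact (Suc k))"
    by (simp_all add: n)
  have "(fact (2 * Suc k) :: real) = 2 * real (Suc k) * (real (Suc n) * fact (2 * k))"
    by (simp add: n algebra_simps)
  moreover have "(2 ^ Suc k * fact (Suc k) :: real) = 2 * real (Suc k) * (2 ^ k * fact k)"
    by (simp add: algebra_simps)
  ultimately show ?thesis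
    unfolding g by (simp del: of_nat_Suc fact_Suc power_Suc)
next
  case False
  then obtain k where n: "n = 2 * k + 1" by (auto elim: oddE)
  have "gauss_mean (monom 1 (2 * j + 1)) = 0" for j
    using integral_std_normal_moment_odd[of j] by (simp add: gauss_mean_def poly_monom)
  from this[of k] this[of "Suc k"] show ?thesis
    unfolding n by simp
qed

lemma gauss_mean_pCons_0: "gauss_mean (pCons 0 p) = gauss_mean (pderiv p)"
proof -
  have mono: "gauss_mean (pCons 0 (monom c n)) = gauss_mean (pderiv (monom c n))" for c n
  proof (cases n)
    case 0
    have "gauss_mean (monom 1 (Suc 0)) = 0"
      using integral_std_normal_moment_odd[of 0] by (simp add: gauss_mean_def poly_monom)
    moreover have "pCons 0 (monom c 0) = Polynomial.smult c (monom 1 (Suc 0))"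
      by (simp add: monom_Suc smult_monom monom_0)
    ultimately show ?thesis
      by (simp only: 0 gauss_mean_smult) (simp add: pderiv_monom gauss_mean_def)
  next
    case (Suc k)
    have "pCons 0 (monom c n) = Polynomial.smult c (monom 1 (Suc (Suc k)))"
      by (simp add: monom_Suc smult_monom Suc)
    moreover have "pderiv (monom c n) = Polynomial.smult (c * real (Suc k)) (monom 1 k)"
      by (simp add: smult_monom Suc pderiv_monom mult.commute)
    ultimately show ?thesis
      by (simp only: gauss_mean_smult gauss_mean_monom_rec)
  qed
  have "gauss_mean (pCons 0 (\<Sum>i\<le>k. monom (coeff p i) i)) = gauss_mean (pderiv (\<Sum>i\<le>k. monom (coeff p i) i))" for k
  proof (induction k)
    case 0
    show ?case using mono[of "coeff p 0" 0] by simp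
  next
    case (Suc k)
    have "pCons 0 (\<Sum>i\<le>Suc k. monom (coeff p i) i) =
        pCons 0 (\<Sum>i\<le>k. monom (coeff p i) i) + pCons 0 (monom (coeff p (Suc k)) (Suc k))"
      by simp
    with Suc mono[of "coeff p (Suc k)" "Suc k"] show ?case
      by (simp only: gauss_mean_add pderiv_add sum.atMost_Suc)
  qed
  from this[of "degree p"] show ?thesis by (simp only: poly_as_sum_of_monoms)
qed

fun hermite_poly :: "nat \<Rightarrow> real poly" where
  "hermite_poly 0 = 1"
| "hermite_poly (Suc 0) = [:0, 1:]"
| "hermite_poly (Suc (Suc k)) =
     pCons 0 (hermite_poly (Suc k)) - Polynomial.smult (real (Suc k)) (hermite_poly k)"

lemma poly_hermite_poly: "poly (hermite_poly k) x = He k x"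
  by (induction k rule: hermite_poly.induct) simp_all

lemma pderiv_hermite_poly:
  "pderiv (hermite_poly (Suc k)) = Polynomial.smult (real (Suc k)) (hermite_poly k)"
proof (induction k rule: less_induct)
  case (less k)
  show ?case
  proof (cases k)
    case 0
    then show ?thesis by (simp add: pderiv_pCons)
  next
    case k: (Suc l)
    show ?thesis
    proof (cases l)
      case 0
      then show ?thesis by (simp add: k pderiv_pCons pderiv_diff pderiv_smult)
    next
      case (Suc i)
      then have D: "pderiv (hermite_poly l) = Polynomial.smult (real l) (hermite_poly i)"
        using less[of i] by (simp add: k del: of_nat_Suc)
      have "pderiv (hermite_poly (Suc k)) = hermite_poly (Suc l)
          + pCons 0 (Polynomial.smult (real (Suc l)) (hermite_poly l))
          - Polynomial.smult (real (Suc l)) (Polynomial.smult (real l) (hermite_poly i))"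
        using less[of l] by (simp add: k pderiv_pCons pderiv_diff pderiv_smult D del: of_nat_Suc)
      also have "\<dots> = hermite_poly (Suc l) + Polynomial.smult (real (Suc l)) (hermite_poly (Suc l))"
        by (simp add: Suc smult_diff_right mult_ac del: of_nat_Suc)
      also have "\<dots> = Polynomial.smult (real (Suc k)) (hermite_poly k)"
        using smult_add_left[of 1 "real (Suc l)" "hermite_poly k"] by (simp add: k)
      finally show ?thesis .
    qed
  qed
qed

lemma hermite_poly_Suc:
  "hermite_poly (Suc k) = pCons 0 (hermite_poly k) - pderiv (hermite_poly k)"
proof (cases k)
  case 0
  then show ?thesis by (simp add: one_pCons)
next
  case (Suc l)
  then show ?thesis using pderiv_hermite_poly[of l] by simp
qed

lemma gauss_mean_hermite_Suc_mult:
  "gauss_mean (hermite_poly (Suc j) * q) = gauss_mean (hermite_poly j * pderiv q)"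
proof -
  have "hermite_poly (Suc j) * q = pCons 0 (hermite_poly j * q) - pderiv (hermite_poly j) * q"
    by (simp add: hermite_poly_Suc algebra_simps)
  then show ?thesis
    by (simp add: gauss_mean_diff gauss_mean_pCons_0 pderiv_mult gauss_mean_add mult.commute)
qed

lemma gauss_mean_hermite_mult:
  "gauss_mean (hermite_poly j * hermite_poly k) = (if j = k then fact k else 0)"
proof (induction j arbitrary: k)
  case 0
  show ?case
  proof (cases k)
    case 0
    have "gauss_mean 1 = 1"
      using integral_std_normal_moment_even[of 0] by (simp add: gauss_mean_def)
    with 0 show ?thesis by simp
  next
    case (Suc l)
    have "gauss_mean (hermite_poly k * 1) = 0"
      unfolding Suc gauss_mean_hermite_Suc_mult by (simp add: gauss_mean_def)
    then show ?thesis using Suc by simp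
  qed
next
  case (Suc j)
  show ?case
  proof (cases k)
    case 0
    then show ?thesis
      using gauss_mean_hermite_Suc_mult[of j 1] by (simp add: gauss_mean_def)
  next
    case (Suc l)
    then show ?thesis
      by (simp only: gauss_mean_hermite_Suc_mult pderiv_hermite_poly mult_smult_right
          gauss_mean_smult Suc.IH) auto
  qed
qed

lemma integrable_gauss_He_normalized_mult:
  "integrable lborel (\<lambda>x. std_normal_density x * (He_normalized j x * He_normalized k x))"
proof -
  have "integrable lborel (\<lambda>x. std_normal_density x * poly (hermite_poly j * hermite_poly k) x
      / (sqrt (fact j) * sqrt (fact k)))"
    by (intro integrable_divide integrable_gauss_poly)
  then show ?thesis by (simp add: poly_hermite_poly He_normalized_def mult_ac)
qed

lemma integral_gauss_He_normalized_mult: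
  "(LINT x|lborel. std_normal_density x * (He_normalized j x * He_normalized k x))
    = (if j = k then 1 else 0)"
proof -
  have "(LINT x|lborel. std_normal_density x * (He_normalized j x * He_normalized k x))
      = gauss_mean (hermite_poly j * hermite_poly k) / (sqrt (fact j) * sqrt (fact k))"
    unfolding gauss_mean_def
    by (subst integral_divide_zero [symmetric], rule Bochner_Integration.integral_cong)
      (simp_all add: poly_hermite_poly He_normalized_def mult_ac)
  then show ?thesis by (simp add: gauss_mean_hermite_mult)
qed

lemma x_mult_He_normalized_0: "x * He_normalized 0 x = He_normalized (Suc 0) x"
  by (simp add: He_normalized_def)

lemma x_mult_He_normalized_Suc:
  "x * He_normalized (Suc k) x =
     sqrt (real (Suc (Suc k))) * He_normalized (Suc (Suc k)) x + sqrt (real (Suc k)) * He_normalized k x"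
proof -
  have 1: "sqrt (real (Suc n)) * (y / sqrt (fact (Suc n))) = y / sqrt (fact n)" for n y
    by (simp add: real_sqrt_mult del: of_nat_Suc)
  have 2: "sqrt (real (Suc n)) * (y / sqrt (fact n)) = real (Suc n) * y / sqrt (fact (Suc n))" for n y
  proof -
    have "real (Suc n) = sqrt (real (Suc n)) * sqrt (real (Suc n))" by simp
    then show ?thesis by (simp add: real_sqrt_mult field_simps del: of_nat_Suc)
  qed
  show ?thesis
    unfolding He_normalized_def 1 2 by (simp add: add_divide_distrib[symmetric] del: of_nat_Suc)
qed

lemma integrable_gauss_x_He_normalized_mult:
  "integrable lborel (\<lambda>x. std_normal_density x * (x * He_normalized j x * He_normalized k x))"
proof -
  have "integrable lborel (\<lambda>x. std_normal_density x * poly (pCons 0 (hermite_poly j * hermite_poly k)) x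
      / (sqrt (fact j) * sqrt (fact k)))"
    by (intro integrable_divide integrable_gauss_poly)
  then show ?thesis by (simp add: poly_hermite_poly He_normalized_def mult_ac)
qed

lemma integral_gauss_x_He_normalized_mult:
  "(LINT x|lborel. std_normal_density x * (x * He_normalized j x * He_normalized k x))
    = (if j = Suc k then sqrt (real j) else if k = Suc j then sqrt (real k) else 0)"
proof (cases j)
  case 0
  then show ?thesis
    by (simp add: x_mult_He_normalized_0 integral_gauss_He_normalized_mult)
next
  case (Suc l)
  have "(LINT x|lborel. std_normal_density x * (x * He_normalized j x * He_normalized k x)) =
    (LINT x|lborel. sqrt (real (Suc (Suc l))) * (std_normal_density x * (He_normalized (Suc (Suc l)) x * He_normalized k x))
     + sqrt (real (Suc l)) * (std_normal_density x * (He_normalized l x * He_normalized k x)))"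
    unfolding Suc x_mult_He_normalized_Suc
    by (rule Bochner_Integration.integral_cong) (simp_all add: algebra_simps del: of_nat_Suc)
  also have "\<dots> = sqrt (real (Suc (Suc l))) * (if Suc (Suc l) = k then 1 else 0) + sqrt (real (Suc l)) * (if l = k then 1 else 0)"
    by (subst Bochner_Integration.integral_add)
      (simp_all only: integrable_gauss_He_normalized_mult integral_gauss_He_normalized_mult
        integral_mult_right_zero integrable_mult_right)
  finally show ?thesis using Suc by auto
qed

lemma borel_measurable_He_normalized [measurable]: "He_normalized k \<in> borel_measurable borel"
proof -
  have "(\<lambda>x. poly (hermite_poly k) x / sqrt (fact k)) \<in> borel_measurable borel"
    by (intro borel_measurable_continuous_onI continuous_intros) auto
  then show ?thesis by (simp add: poly_hermite_poly He_normalized_def[abs_def])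
qed

lemma integrable_gauss_abs_He_normalized_mult:
  "integrable lborel (\<lambda>x. std_normal_density x * (\<bar>x\<bar> * He_normalized j x * He_normalized k x))"
  by (rule Bochner_Integration.integrable_bound[OF integrable_gauss_x_He_normalized_mult[of j k]])
    (auto simp: abs_mult)

lemma lborel_integral_prod_mult:
  fixes f :: "'a::euclidean_space \<Rightarrow> real" and g :: "'b::euclidean_space \<Rightarrow> real"
  assumes f: "integrable lborel f" and g: "integrable lborel g"
  shows "integrable lborel (\<lambda>(x, y). f x * g y)"
    and "(LINT z|lborel. (case z of (x, y) \<Rightarrow> f x * g y)) = integral\<^sup>L lborel f * integral\<^sup>L lborel g"
proof -
  have [measurable]: "f \<in> borel_measurable borel" "g \<in> borel_measurable borel"
    using f g by (auto dest: borel_measurable_integrable)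
  have i: "integrable (lborel \<Otimes>\<^sub>M lborel) (\<lambda>(x, y). f x * g y)"
    by (rule lborel_pair.Fubini_integrable) (use f g in \<open>auto simp: abs_mult\<close>)
  then show "integrable lborel (\<lambda>(x, y). f x * g y)" by (simp add: lborel_prod)
  show "(LINT z|lborel. (case z of (x, y) \<Rightarrow> f x * g y)) = integral\<^sup>L lborel f * integral\<^sup>L lborel g"
    using lborel_pair.integral_fst'[OF i] by (simp add: lborel_prod)
qed

lemma maxwellian_eq:
  "maxwellian (x, y, z) = std_normal_density x * std_normal_density y * std_normal_density z"
proof -
  have "(2 * pi) powr (3 / 2) = ((2 * pi) powr (1 / 2)) powr 3"
    by (simp only: powr_powr) simp
  also have "\<dots> = sqrt (2 * pi) ^ 3"
    by (simp only: powr_half_sqrt pi_ge_zero mult_nonneg_nonneg zero_le_numeral) (simp add: powr_numeral)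
  finally have "(2 * pi) powr (- 3 / 2) = 1 / sqrt (2 * pi) ^ 3"
    by (simp only: minus_divide_left[symmetric] powr_minus_divide)
  moreover have "- (norm (x, y, z))\<^sup>2 / 2 = - x\<^sup>2 / 2 + - y\<^sup>2 / 2 + - z\<^sup>2 / 2"
    by (simp add: norm_Pair)
  ultimately show ?thesis
    by (simp only: maxwellian_def std_normal_density_def exp_add) (simp add: power3_eq_cube)
qed

lemma maxwellian_weighted_integral:
  fixes g :: "real \<Rightarrow> real"
  assumes g: "integrable lborel (\<lambda>x. std_normal_density x * (g x * He_normalized a2 x * He_normalized b2 x))"
  shows "integrable lborel (\<lambda>\<xi>. g (xi2 \<xi>) * maxwellian \<xi> * phi (a1, a2, a3) \<xi> * phi (b1, b2, b3) \<xi>)"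
    and "(LINT \<xi>|lborel. g (xi2 \<xi>) * maxwellian \<xi> * phi (a1, a2, a3) \<xi> * phi (b1, b2, b3) \<xi>) =
      (if a1 = b1 \<and> a3 = b3
       then LINT x|lborel. std_normal_density x * (g x * He_normalized a2 x * He_normalized b2 x) else 0)"
proof -
  let ?h = "\<lambda>a b x. std_normal_density x * (He_normalized a x * He_normalized b x)"
  let ?k = "\<lambda>x. std_normal_density x * (g x * He_normalized a2 x * He_normalized b2 x)"
  have eq: "(\<lambda>\<xi>. g (xi2 \<xi>) * maxwellian \<xi> * phi (a1, a2, a3) \<xi> * phi (b1, b2, b3) \<xi>) =
      (\<lambda>(x, p). ?h a1 b1 x * (case p of (y, z) \<Rightarrow> ?k y * ?h a3 b3 z))"
    by (auto simp: fun_eq_iff phi_def xi2_def maxwellian_eq)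
  note p = lborel_integral_prod_mult[OF g integrable_gauss_He_normalized_mult[of a3 b3]]
  note q = lborel_integral_prod_mult[OF integrable_gauss_He_normalized_mult[of a1 b1] p(1)]
  show "integrable lborel (\<lambda>\<xi>. g (xi2 \<xi>) * maxwellian \<xi> * phi (a1, a2, a3) \<xi> * phi (b1, b2, b3) \<xi>)"
    unfolding eq by (rule q(1))
  show "(LINT \<xi>|lborel. g (xi2 \<xi>) * maxwellian \<xi> * phi (a1, a2, a3) \<xi> * phi (b1, b2, b3) \<xi>) =
      (if a1 = b1 \<and> a3 = b3 then integral\<^sup>L lborel ?k else 0)"
    unfolding eq q(2) p(2) integral_gauss_He_normalized_mult by simp
qed

lemma phi_orthonormal:
  shows "integrable lborel (\<lambda>\<xi>. maxwellian \<xi> * phi \<alpha> \<xi> * phi \<beta> \<xi>)"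
    and "(LINT \<xi>|lborel. maxwellian \<xi> * phi \<alpha> \<xi> * phi \<beta> \<xi>) = (if \<alpha> = \<beta> then 1 else 0)"
proof -
  obtain a1 a2 a3 b1 b2 b3 where [simp]: "\<alpha> = (a1, a2, a3)" "\<beta> = (b1, b2, b3)"
    by (metis prod_cases3)
  have i: "integrable lborel (\<lambda>x. std_normal_density x * (1 * He_normalized a2 x * He_normalized b2 x))"
    using integrable_gauss_He_normalized_mult[of a2 b2] by simp
  note p = maxwellian_weighted_integral[where g = "\<lambda>_. 1", OF i]
  show "integrable lborel (\<lambda>\<xi>. maxwellian \<xi> * phi \<alpha> \<xi> * phi \<beta> \<xi>)"
    using p(1)[of a1 a3 b1 b3] by simp
  show "(LINT \<xi>|lborel. maxwellian \<xi> * phi \<alpha> \<xi> * phi \<beta> \<xi>) = (if \<alpha> = \<beta> then 1 else 0)"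
    using p(2)[of a1 a3 b1 b3] by (simp add: integral_gauss_He_normalized_mult)
qed

lemma phi_xi2_integral:
  "(LINT \<xi>|lborel. xi2 \<xi> * maxwellian \<xi> * phi (a1, a2, a3) \<xi> * phi (b1, b2, b3) \<xi>) =
    (if a1 = b1 \<and> a3 = b3 then
      if a2 = Suc b2 then sqrt (real a2) else if b2 = Suc a2 then sqrt (real b2) else 0
     else 0)"
  using maxwellian_weighted_integral(2)[where g = "\<lambda>x. x", OF integrable_gauss_x_He_normalized_mult]
  by (simp add: integral_gauss_x_He_normalized_mult)

lemma integrable_phi_abs_xi2:
  "integrable lborel (\<lambda>\<xi>. \<bar>xi2 \<xi>\<bar> * maxwellian \<xi> * phi \<alpha> \<xi> * phi \<beta> \<xi>)"
  using maxwellian_weighted_integral(1)[where g = abs, OF integrable_gauss_abs_He_normalized_mult[of "fst (snd \<alpha>)" "fst (snd \<beta>)"], of "fst \<alpha>" "snd (snd \<alpha>)" "fst \<beta>" "snd (snd \<beta>)"]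
  by simp

lemma AE_xi2_nonzero: "AE \<xi> in lborel. xi2 \<xi> \<noteq> 0"
proof -
  have eq: "{\<xi>. xi2 \<xi> = 0} = {\<xi>. Inner_Product.inner (0, 1, 0) \<xi> = (0::real)}"
    by (auto simp: xi2_def)
  then have "negligible {\<xi>. xi2 \<xi> = 0}"
    using negligible_hyperplane[of "(0, 1, 0) :: real \<times> real \<times> real" 0] by (simp add: zero_prod_def)
  moreover have "{\<xi>. xi2 \<xi> = 0} \<in> sets lborel"
    unfolding eq by (simp add: closed_hyperplane)
  ultimately have "{\<xi>. xi2 \<xi> = 0} \<in> null_sets lborel"
    by (simp add: negligible_iff_null_sets null_sets_completion_iff)
  then show ?thesis by (auto intro: AE_I')
qed

lemma S_mat_carrier [simp]: "S_mat M \<in> carrier_mat (m_dim M) (m_dim M)"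
  by (simp add: S_mat_def)

lemma S_mat_quadratic_form:
  assumes v: "v \<in> carrier_vec (m_dim M)"
  shows "integrable lborel
      (\<lambda>\<xi>. \<bar>xi2 \<xi>\<bar> * maxwellian \<xi> * (\<Sum>i<m_dim M. v $ i * phi (even_list M ! i) \<xi>)\<^sup>2)"
    and "v \<bullet> (S_mat M *\<^sub>v v) = sqrt (2 * pi) / 2 *
      (LINT \<xi>|lborel. \<bar>xi2 \<xi>\<bar> * maxwellian \<xi> * (\<Sum>i<m_dim M. v $ i * phi (even_list M ! i) \<xi>)\<^sup>2)"
proof -
  let ?f = "\<lambda>i j \<xi>. \<bar>xi2 \<xi>\<bar> * maxwellian \<xi> * phi (even_list M ! i) \<xi> * phi (even_list M ! j) \<xi>"
  have eq: "\<bar>xi2 \<xi>\<bar> * maxwellian \<xi> * (\<Sum>i<m_dim M. v $ i * phi (even_list M ! i) \<xi>)\<^sup>2 =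
      (\<Sum>i<m_dim M. \<Sum>j<m_dim M. v $ i * v $ j * ?f i j \<xi>)" for \<xi>
    by (simp add: power2_eq_square sum_product sum_distrib_left mult_ac)
  show "integrable lborel
      (\<lambda>\<xi>. \<bar>xi2 \<xi>\<bar> * maxwellian \<xi> * (\<Sum>i<m_dim M. v $ i * phi (even_list M ! i) \<xi>)\<^sup>2)"
    unfolding eq by (intro Bochner_Integration.integrable_sum integrable_mult_right integrable_phi_abs_xi2)
  have "(LINT \<xi>|lborel. \<bar>xi2 \<xi>\<bar> * maxwellian \<xi> * (\<Sum>i<m_dim M. v $ i * phi (even_list M ! i) \<xi>)\<^sup>2) =
      (\<Sum>i<m_dim M. \<Sum>j<m_dim M. v $ i * v $ j * integral\<^sup>L lborel (?f i j))"
    unfolding eq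
    by (simp add: integrable_phi_abs_xi2 Bochner_Integration.integral_sum
        Bochner_Integration.integrable_sum)
  moreover have "v \<bullet> (S_mat M *\<^sub>v v) =
      (\<Sum>i<m_dim M. \<Sum>j<m_dim M. v $ i * v $ j * (sqrt (2 * pi) / 2 * integral\<^sup>L lborel (?f i j)))"
    using v by (simp add: scalar_prod_def S_mat_def sum_distrib_left mult_ac atLeast0LessThan)
  ultimately show "v \<bullet> (S_mat M *\<^sub>v v) = sqrt (2 * pi) / 2 *
      (LINT \<xi>|lborel. \<bar>xi2 \<xi>\<bar> * maxwellian \<xi> * (\<Sum>i<m_dim M. v $ i * phi (even_list M ! i) \<xi>)\<^sup>2)"
    by (simp add: sum_distrib_left mult_ac)
qed

text \<open>If the quadratic form vanishes at \<open>v\<close>, then \<open>\<Sum>i. v\<^sub>i \<phi>\<^sub>i\<close> vanishes almost everywhere, and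
  orthonormality recovers each coefficient as \<open>0\<close>.\<close>

lemma S_mat_pos_def:
  assumes v: "v \<in> carrier_vec (m_dim M)" and nz: "v \<noteq> 0\<^sub>v (m_dim M)"
  shows "v \<bullet> (S_mat M *\<^sub>v v) > 0"
proof -
  let ?m = "m_dim M"
  let ?p = "\<lambda>\<xi>. \<Sum>i<?m. v $ i * phi (even_list M ! i) \<xi>"
  let ?q = "\<lambda>\<xi>. \<bar>xi2 \<xi>\<bar> * maxwellian \<xi> * (?p \<xi>)\<^sup>2"
  have pos: "maxwellian \<xi> > 0" for \<xi>
    by (simp add: maxwellian_def)
  have q0: "0 \<le> ?q \<xi>" for \<xi>
    using pos[of \<xi>] by simp
  have "integral\<^sup>L lborel ?q \<noteq> 0"
  proof
    assume "integral\<^sup>L lborel ?q = 0"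
    then have "AE \<xi> in lborel. ?q \<xi> = 0"
      using integral_nonneg_eq_0_iff_AE[OF S_mat_quadratic_form(1)[OF v]] q0 by simp
    with AE_xi2_nonzero have p0: "AE \<xi> in lborel. ?p \<xi> = 0"
      by eventually_elim (use pos in \<open>auto simp: less_le\<close>)
    have "v $ k = 0" if k: "k < ?m" for k
    proof -
      have "integral\<^sup>L lborel (\<lambda>\<xi>. maxwellian \<xi> * ?p \<xi> * phi (even_list M ! k) \<xi>) = 0"
        by (rule integral_eq_zero_AE) (use p0 in \<open>eventually_elim, simp\<close>)
      moreover have "integral\<^sup>L lborel (\<lambda>\<xi>. maxwellian \<xi> * ?p \<xi> * phi (even_list M ! k) \<xi>) =
          integral\<^sup>L lborel (\<lambda>\<xi>. \<Sum>i<?m. v $ i * (maxwellian \<xi> * phi (even_list M ! i) \<xi> * phi (even_list M ! k) \<xi>))"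
        by (simp add: sum_distrib_left sum_distrib_right mult_ac)
      moreover have "\<dots> = (\<Sum>i<?m. v $ i * (if even_list M ! i = even_list M ! k then 1 else 0))"
        by (subst Bochner_Integration.integral_sum)
          (simp_all only: phi_orthonormal integral_mult_right_zero integrable_mult_right)
      moreover have "\<dots> = (\<Sum>i<?m. if i = k then v $ i else 0)"
        by (rule sum.cong) (use k in \<open>auto simp: nth_eq_iff_index_eq even_list_props(2) length_index_lists\<close>)
      ultimately show ?thesis using k by simp
    qed
    then have "v = 0\<^sub>v ?m" using v by auto
    with nz show False by simp
  qed
  moreover have "integral\<^sup>L lborel ?q \<ge> 0"
    by (rule Bochner_Integration.integral_nonneg) (use q0 in simp)
  ultimately have "integral\<^sup>L lborel ?q > 0" by simp
  then show ?thesis by (simp add: S_mat_quadratic_form(2)[OF v])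
qed

section \<open>Spectrum of symmetric bipartite matrices\<close>

definition nonneg_root_count :: "real poly \<Rightarrow> nat" where
  "nonneg_root_count p = (\<Sum>k \<in> {k. poly p k = 0 \<and> 0 \<le> k}. Polynomial.order k p)"

lemma nonneg_root_count_mult:
  assumes "p \<noteq> 0" and "q \<noteq> 0"
  shows "nonneg_root_count (p * q) = nonneg_root_count p + nonneg_root_count q"
proof -
  let ?Z = "\<lambda>r. {k. poly r k = 0 \<and> (0::real) \<le> k}"
  have fin: "finite (?Z (p * q))"
    using poly_roots_finite[of "p * q"] assms by (auto intro: finite_subset[rotated])
  have "(\<Sum>k \<in> ?Z p. Polynomial.order k p) = (\<Sum>k \<in> ?Z (p * q). Polynomial.order k p)"
    "(\<Sum>k \<in> ?Z q. Polynomial.order k q) = (\<Sum>k \<in> ?Z (p * q). Polynomial.order k q)"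
    by (rule sum.mono_neutral_left[OF fin]; auto intro!: order_0I)+
  then show ?thesis
    using assms by (simp add: nonneg_root_count_def order_mult sum.distrib)
qed

lemma nonneg_root_count_linear:
  "nonneg_root_count [:- a, 1:] = (if 0 \<le> a then 1 else 0)"
proof -
  have "{k. poly [:- a, 1:] k = 0 \<and> 0 \<le> k} = (if 0 \<le> a then {a} else {})" by auto
  moreover have "Polynomial.order a [:- a, 1:] = 1"
    using order_power_n_n[of a 1] by simp
  ultimately show ?thesis by (simp add: nonneg_root_count_def)
qed

lemma nonneg_root_count_monom: "nonneg_root_count (monom 1 n) = n"
proof (induction n)
  case 0
  show ?case by (simp add: nonneg_root_count_def)
next
  case (Suc n)
  have "nonneg_root_count ([:- 0, 1:] * monom 1 n) = Suc n"
    by (subst nonneg_root_count_mult) (simp_all only: nonneg_root_count_linear Suc, simp_all)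
  then show ?case by (simp add: monom_Suc)
qed

lemma nonneg_root_count_square_prod:
  assumes "\<And>l. l \<in> set ls \<Longrightarrow> 0 < l"
  shows "(\<Prod>l\<leftarrow>ls. [:- l, 0, 1:]) \<noteq> 0 \<and>
    nonneg_root_count (\<Prod>l\<leftarrow>ls. [:- l, 0, 1:]) = length ls"
  using assms
proof (induction ls)
  case Nil
  show ?case by (simp add: nonneg_root_count_def)
next
  case (Cons l ls)
  from Cons.prems have l: "0 < l" by simp
  have "[:- l, 0, 1:] = [:- sqrt l, 1:] * [:- (- sqrt l), 1:]" using l by simp
  then have "nonneg_root_count [:- l, 0, 1:] =
      nonneg_root_count [:- sqrt l, 1:] + nonneg_root_count [:- (- sqrt l), 1:]"
    by (simp only: nonneg_root_count_mult pCons_eq_0_iff one_neq_zero simp_thms not_False_eq_True)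
  also have "\<dots> = 1"
    unfolding nonneg_root_count_linear using l by simp
  finally have 1: "nonneg_root_count [:- l, 0, 1:] = 1" .
  from Cons have IH: "(\<Prod>l\<leftarrow>ls. [:- l, 0, 1:]) \<noteq> 0"
    "nonneg_root_count (\<Prod>l\<leftarrow>ls. [:- l, 0, 1:]) = length ls" by auto
  have "nonneg_root_count ([:- l, 0, 1:] * (\<Prod>l\<leftarrow>ls. [:- l, 0, 1:])) = 1 + length ls"
    by (subst nonneg_root_count_mult) (use IH 1 in auto)
  then show ?case using IH(1) by (simp del: mult_pCons_left)
qed

text \<open>Real and imaginary parts of a complex eigenvector satisfy a coupled real system, in which
  symmetry forces the imaginary part of the eigenvalue to vanish.\<close>

lemma complex_eigenvalue_pos_def:
  fixes B :: "real mat"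
  assumes B: "B \<in> carrier_mat n n" and sym: "transpose_mat B = B"
    and pos: "\<And>v. v \<in> carrier_vec n \<Longrightarrow> v \<noteq> 0\<^sub>v n \<Longrightarrow> 0 < v \<bullet> (B *\<^sub>v v)"
    and ev: "eigenvalue (map_mat complex_of_real B) z"
  shows "\<exists>l>0. z = complex_of_real l"
proof -
  obtain w where w: "w \<in> carrier_vec n" "w \<noteq> 0\<^sub>v n" "map_mat complex_of_real B *\<^sub>v w = z \<cdot>\<^sub>v w"
    using ev B by (auto simp: eigenvalue_def eigenvector_def)
  define a where "a = map_vec Re w"
  define b where "b = map_vec Im w"
  have a: "a \<in> carrier_vec n" and b: "b \<in> carrier_vec n"
    using w(1) by (auto simp: a_def b_def)
  have row: "(\<Sum>j<n. complex_of_real (B $$ (i, j)) * w $ j) = z * w $ i" if "i < n" for i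
    using arg_cong[OF w(3), of "\<lambda>v. v $ i"] that B w(1)
    by (simp add: scalar_prod_def atLeast0LessThan)
  have Ba: "(B *\<^sub>v a) $ i = Re z * a $ i - Im z * b $ i" if "i < n" for i
    using arg_cong[OF row[OF that], of Re] that B w(1) a
    by (simp add: scalar_prod_def atLeast0LessThan a_def b_def)
  have Bb: "(B *\<^sub>v b) $ i = Re z * b $ i + Im z * a $ i" if "i < n" for i
    using arg_cong[OF row[OF that], of Im] that B w(1) b
    by (simp add: scalar_prod_def atLeast0LessThan a_def b_def)
  have dimB: "dim_row B = n" using B by simp
  have dot: "u \<bullet> (B *\<^sub>v v) = (\<Sum>i<n. u $ i * (B *\<^sub>v v) $ i)" for u v
    unfolding scalar_prod_def dim_mult_mat_vec dimB by (simp add: atLeast0LessThan)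
  have "b \<bullet> (B *\<^sub>v a) = a \<bullet> (B *\<^sub>v b)"
    using transpose_vec_mult_scalar[OF B a b] comm_scalar_prod[of "B *\<^sub>v b" n a] B a b
    by (simp add: sym)
  then have "(\<Sum>i<n. b $ i * (Re z * a $ i - Im z * b $ i)) = (\<Sum>i<n. a $ i * (Re z * b $ i + Im z * a $ i))"
    by (simp add: dot Ba Bb)
  then have "Im z * (\<Sum>i<n. (a $ i)\<^sup>2 + (b $ i)\<^sup>2) = 0"
    by (simp add: sum_distrib_left sum.distrib sum_subtractf algebra_simps power2_eq_square)
  moreover have ab: "a \<noteq> 0\<^sub>v n \<or> b \<noteq> 0\<^sub>v n"
  proof (rule ccontr)
    assume "\<not> ?thesis"
    then have "map_vec Re w = 0\<^sub>v n" "map_vec Im w = 0\<^sub>v n" by (simp_all add: a_def b_def)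
    then have "w $ i = 0" if "i < n" for i
      using that w(1) by (metis complex_eqI carrier_vecD index_map_vec(1) index_zero_vec(1) zero_complex.simps)
    with w(1,2) show False by auto
  qed
  moreover have "(\<Sum>i<n. (a $ i)\<^sup>2 + (b $ i)\<^sup>2) \<noteq> 0"
  proof
    assume "(\<Sum>i<n. (a $ i)\<^sup>2 + (b $ i)\<^sup>2) = 0"
    then have "\<forall>i<n. (a $ i)\<^sup>2 + (b $ i)\<^sup>2 = 0"
      by (subst (asm) sum_nonneg_eq_0_iff) auto
    then have "a = 0\<^sub>v n" "b = 0\<^sub>v n"
      using a b by (auto simp: sum_power2_eq_zero_iff)
    with ab show False by simp
  qed
  ultimately have Im: "Im z = 0" by simp
  have "0 < Re z" if v: "v \<in> carrier_vec n" "v \<noteq> 0\<^sub>v n" and Bv: "\<And>i. i < n \<Longrightarrow> (B *\<^sub>v v) $ i = Re z * v $ i" for v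
  proof -
    have "v \<bullet> (B *\<^sub>v v) = Re z * (\<Sum>i<n. (v $ i)\<^sup>2)"
      by (simp add: dot Bv sum_distrib_left power2_eq_square mult_ac)
    with pos[OF v] have "0 < Re z * (\<Sum>i<n. (v $ i)\<^sup>2)" by simp
    moreover have "0 \<le> (\<Sum>i<n. (v $ i)\<^sup>2)" by (simp add: sum_nonneg)
    ultimately show ?thesis by (simp add: zero_less_mult_iff)
  qed
  from this[of a] this[of b] ab a b have "0 < Re z" by (auto simp: Ba Bb Im)
  moreover have "z = complex_of_real (Re z)" using Im by (simp add: complex_eq_iff)
  ultimately show ?thesis by blast
qed

lemma char_poly_pos_def_splits:
  fixes B :: "real mat"
  assumes B: "B \<in> carrier_mat n n" and sym: "transpose_mat B = B"
    and pos: "\<And>v. v \<in> carrier_vec n \<Longrightarrow> v \<noteq> 0\<^sub>v n \<Longrightarrow> 0 < v \<bullet> (B *\<^sub>v v)"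
  obtains ls where "char_poly B = (\<Prod>l\<leftarrow>ls. [:- l, 1:])" "length ls = n" "\<And>l. l \<in> set ls \<Longrightarrow> 0 < l"
proof -
  let ?C = "map_mat complex_of_real B"
  have C: "?C \<in> carrier_mat n n" using B by simp
  obtain as where as: "char_poly ?C = (\<Prod>a\<leftarrow>as. [:- a, 1:])" "length as = n"
    using char_poly_factorized[OF C] by blast
  have real: "\<exists>l>0. a = complex_of_real l" if "a \<in> set as" for a
  proof (rule complex_eigenvalue_pos_def[OF B sym pos])
    have "poly (char_poly ?C) a = 0"
      using that unfolding as(1) poly_prod_list prod_list_zero_iff by force
    then show "eigenvalue ?C a" using eigenvalue_root_char_poly[OF C] by simp
  qed
  define ls where "ls = map Re as"
  have ls: "as = map complex_of_real ls" "\<forall>l\<in>set ls. 0 < l"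
    unfolding ls_def using real by (auto simp: list_eq_iff_nth_eq in_set_conv_nth)
      (metis Re_complex_of_real nth_mem)+
  have "map_poly complex_of_real (char_poly B) = (\<Prod>a\<leftarrow>as. [:- a, 1:])"
    using of_real_hom.char_poly_hom[OF B, where 'a=complex] as(1) by simp
  also have "\<dots> = map_poly complex_of_real (\<Prod>l\<leftarrow>ls. [:- l, 1:])"
  proof -
    interpret h: map_poly_comm_ring_hom complex_of_real ..
    show ?thesis unfolding ls(1) h.hom_prod_list by (simp add: o_def hom_distribs)
  qed
  finally have "char_poly B = (\<Prod>l\<leftarrow>ls. [:- l, 1:])"
    by (simp add: poly_eq_iff coeff_map_poly)
  moreover have "length ls = n" using as(2) ls(1) by simp
  ultimately show ?thesis using that ls(2) by blast
qed

lemma char_poly_bipartite: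
  fixes P :: "real mat"
  assumes P: "P \<in> carrier_mat m n"
  shows "char_poly (four_block_mat (0\<^sub>m m m) P (transpose_mat P) (0\<^sub>m n n)) * monom 1 n =
    monom 1 m * pcompose (char_poly (transpose_mat P * P)) [:0, 0, 1:]"
proof -
  let ?T = "transpose_mat P"
  let ?A = "four_block_mat (0\<^sub>m m m) P ?T (0\<^sub>m n n)"
  have T: "?T \<in> carrier_mat n m" and TP: "?T * P \<in> carrier_mat n n" using P by auto
  have A: "?A \<in> carrier_mat (m + n) (m + n)" by (rule four_block_carrier_mat) auto
  have "poly (char_poly ?A) k * k ^ n = k ^ m * poly (char_poly (?T * P)) (k\<^sup>2)" for k
  proof -
    let ?X = "four_block_mat (k \<cdot>\<^sub>m 1\<^sub>m m) (- P) (- ?T) (k \<cdot>\<^sub>m 1\<^sub>m n)"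
    let ?Y = "four_block_mat (1\<^sub>m m) P (0\<^sub>m n m) (k \<cdot>\<^sub>m 1\<^sub>m n)"
    have X: "- char_matrix ?A k = ?X"
      by (rule eq_matI) (use P in \<open>auto simp: char_matrix_def\<close>)
    have "?X * ?Y = four_block_mat ((k \<cdot>\<^sub>m 1\<^sub>m m) * 1\<^sub>m m + (- P) * 0\<^sub>m n m) ((k \<cdot>\<^sub>m 1\<^sub>m m) * P + (- P) * (k \<cdot>\<^sub>m 1\<^sub>m n))
        ((- ?T) * 1\<^sub>m m + (k \<cdot>\<^sub>m 1\<^sub>m n) * 0\<^sub>m n m) ((- ?T) * P + (k \<cdot>\<^sub>m 1\<^sub>m n) * (k \<cdot>\<^sub>m 1\<^sub>m n))"
      by (rule mult_four_block_mat) (use P in auto)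
    also have "\<dots> = four_block_mat (k \<cdot>\<^sub>m 1\<^sub>m m) (0\<^sub>m m n) (- ?T) (- char_matrix (?T * P) (k\<^sup>2))"
    proof (rule cong_four_block_mat)
      show "(k \<cdot>\<^sub>m 1\<^sub>m m) * 1\<^sub>m m + (- P) * 0\<^sub>m n m = k \<cdot>\<^sub>m 1\<^sub>m m"
        using P by simp
      show "(k \<cdot>\<^sub>m 1\<^sub>m m) * P + (- P) * (k \<cdot>\<^sub>m 1\<^sub>m n) = 0\<^sub>m m n"
      proof -
        have "(k \<cdot>\<^sub>m 1\<^sub>m m) * P = k \<cdot>\<^sub>m P" using P by (simp add: mult_smult_assoc_mat[of _ m m])
        moreover have "(- P) * (k \<cdot>\<^sub>m 1\<^sub>m n) = k \<cdot>\<^sub>m (- P)"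
          using P mult_smult_distrib[of "- P" m n "1\<^sub>m n" n k] by simp
        ultimately show ?thesis using P by auto
      qed
      show "(- ?T) * 1\<^sub>m m + (k \<cdot>\<^sub>m 1\<^sub>m n) * 0\<^sub>m n m = - ?T"
        using T by simp
      show "(- ?T) * P + (k \<cdot>\<^sub>m 1\<^sub>m n) * (k \<cdot>\<^sub>m 1\<^sub>m n) = - char_matrix (?T * P) (k\<^sup>2)"
      proof -
        have "(k \<cdot>\<^sub>m 1\<^sub>m n) * (k \<cdot>\<^sub>m 1\<^sub>m n) = k\<^sup>2 \<cdot>\<^sub>m 1\<^sub>m n"
          by (simp add: mult_smult_assoc_mat[of _ n n] power2_eq_square)
            (auto simp: mult.assoc)
        moreover have "(- ?T) * P = - (?T * P)" using T P by (simp add: uminus_mult_left_mat)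
        moreover have "- (?T * P) + k\<^sup>2 \<cdot>\<^sub>m 1\<^sub>m n = - char_matrix (?T * P) (k\<^sup>2)"
          by (rule eq_matI) (use P in \<open>auto simp: char_matrix_def\<close>)
        ultimately show ?thesis by simp
      qed
    qed
    finally have XY: "?X * ?Y = four_block_mat (k \<cdot>\<^sub>m 1\<^sub>m m) (0\<^sub>m m n) (- ?T) (- char_matrix (?T * P) (k\<^sup>2))" .
    have Xc: "?X \<in> carrier_mat (m + n) (m + n)" "?Y \<in> carrier_mat (m + n) (m + n)" by auto
    have "det ?X * k ^ n = det ?X * det ?Y"
      by (subst det_four_block_mat_lower_left_zero[of "1\<^sub>m m" m P n]) (use P in auto)
    also have "\<dots> = det (?X * ?Y)" by (rule det_mult[OF Xc, symmetric])
    also have "\<dots> = k ^ m * det (- char_matrix (?T * P) (k\<^sup>2))"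
      unfolding XY by (subst det_four_block_mat_upper_right_zero) (use P TP in auto)
    finally show ?thesis
      by (simp add: char_poly_matrix[OF A] char_poly_matrix[OF TP] X)
  qed
  then have "poly (char_poly ?A * monom 1 n) = poly (monom 1 m * pcompose (char_poly (?T * P)) [:0, 0, 1:])"
    by (simp add: fun_eq_iff poly_monom poly_pcompose power2_eq_square)
  then show ?thesis by (simp only: poly_eq_poly_eq_iff)
qed

lemma pcompose_prod_list_linear:
  "pcompose (\<Prod>l\<leftarrow>ls. [:- l, 1:]) [:0, 0, 1:] = (\<Prod>l\<leftarrow>ls. [:- l, 0, 1 :: real:])"
  by (induction ls) (simp_all add: pcompose_mult pcompose_pCons del: mult_pCons_left)

lemma num_nonneg_eigenvalues_bipartite:
  fixes P :: "real mat"
  assumes P: "P \<in> carrier_mat m n"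
    and inj: "\<And>y. y \<in> carrier_vec n \<Longrightarrow> P *\<^sub>v y = 0\<^sub>v m \<Longrightarrow> y = 0\<^sub>v n"
  shows "num_nonneg_eigenvalues (four_block_mat (0\<^sub>m m m) P (transpose_mat P) (0\<^sub>m n n)) = m"
proof -
  let ?T = "transpose_mat P"
  let ?A = "four_block_mat (0\<^sub>m m m) P ?T (0\<^sub>m n n)"
  have A: "?A \<in> carrier_mat (m + n) (m + n)" by (rule four_block_carrier_mat) auto
  have TP: "?T * P \<in> carrier_mat n n" using P by auto
  have sym: "transpose_mat (?T * P) = ?T * P"
    using P by (simp add: transpose_mult[of _ n m])
  have pos: "0 < v \<bullet> (?T * P *\<^sub>v v)" if v: "v \<in> carrier_vec n" "v \<noteq> 0\<^sub>v n" for v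
  proof -
    have Pv: "P *\<^sub>v v \<in> carrier_vec m" using P v by auto
    have "v \<bullet> (?T * P *\<^sub>v v) = v \<bullet> (?T *\<^sub>v (P *\<^sub>v v))"
      using P v by (simp add: assoc_mult_mat_vec[of _ n m])
    also have "\<dots> = (?T *\<^sub>v (P *\<^sub>v v)) \<bullet> v"
      by (rule comm_scalar_prod[of _ n]) (use P v in auto)
    also have "\<dots> = (P *\<^sub>v v) \<bullet> (P *\<^sub>v v)"
      by (rule transpose_vec_mult_scalar[OF P v(1) Pv])
    also have "\<dots> > 0"
    proof -
      have "P *\<^sub>v v \<noteq> 0\<^sub>v m" using inj[OF v(1)] v(2) by blast
      then obtain i where i: "i < m" "(P *\<^sub>v v) $ i \<noteq> 0"
        using Pv by (metis carrier_vecD eq_vecI index_zero_vec)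
      have "0 < (\<Sum>i<m. (P *\<^sub>v v) $ i * (P *\<^sub>v v) $ i)"
        by (rule sum_pos2[of _ i]) (use i in \<open>auto simp: zero_less_mult_iff\<close>)
      then show ?thesis
        unfolding scalar_prod_def carrier_vecD[OF Pv] by (simp add: atLeast0LessThan)
    qed
    finally show ?thesis .
  qed
  obtain ls where ls: "char_poly (?T * P) = (\<Prod>l\<leftarrow>ls. [:- l, 1:])" "length ls = n" "\<And>l. l \<in> set ls \<Longrightarrow> 0 < l"
    using char_poly_pos_def_splits[OF TP sym pos] by blast
  have A0: "char_poly ?A \<noteq> 0" using degree_monic_char_poly[OF A] by force
  have eq: "char_poly ?A * monom 1 n = monom 1 m * (\<Prod>l\<leftarrow>ls. [:- l, 0, 1:])"
    using char_poly_bipartite[OF P] by (simp add: ls(1) pcompose_prod_list_linear)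
  note q = nonneg_root_count_square_prod[of ls, OF ls(3)]
  have "nonneg_root_count (char_poly ?A * monom 1 n) = nonneg_root_count (char_poly ?A) + n"
    using A0 by (simp add: nonneg_root_count_mult nonneg_root_count_monom)
  moreover have "nonneg_root_count (monom 1 m * (\<Prod>l\<leftarrow>ls. [:- l, 0, 1:])) = m + n"
    using q ls(2) by (simp add: nonneg_root_count_mult nonneg_root_count_monom)
  ultimately have "nonneg_root_count (char_poly ?A) = m" using eq by simp
  then show ?thesis
    by (simp add: num_nonneg_eigenvalues_def nonneg_root_count_def eigenvalue_root_char_poly[OF A])
qed

section \<open>The solution space of the boundary conditions\<close>

lemma pos_def_det_nonzero:
  fixes K :: "real mat"
  assumes K: "K \<in> carrier_mat n n"
    and pos: "\<And>v. v \<in> carrier_vec n \<Longrightarrow> v \<noteq> 0\<^sub>v n \<Longrightarrow> 0 < v \<bullet> (K *\<^sub>v v)"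
  shows "det K \<noteq> 0"
proof
  assume "det K = 0"
  then obtain v where "v \<in> carrier_vec n" "v \<noteq> 0\<^sub>v n" "K *\<^sub>v v = 0\<^sub>v n"
    using det_0_iff_vec_prod_zero[OF K] by blast
  with pos[of v] show False by simp
qed

lemma pos_def_mat_inverse:
  fixes K :: "real mat"
  assumes K: "K \<in> carrier_mat n n"
    and pos: "\<And>v. v \<in> carrier_vec n \<Longrightarrow> v \<noteq> 0\<^sub>v n \<Longrightarrow> 0 < v \<bullet> (K *\<^sub>v v)"
  obtains G where "mat_inverse K = Some G" "G \<in> carrier_mat n n"
    "\<And>v. v \<in> carrier_vec n \<Longrightarrow> K *\<^sub>v (G *\<^sub>v v) = v"
    "\<And>v. v \<in> carrier_vec n \<Longrightarrow> v \<noteq> 0\<^sub>v n \<Longrightarrow> 0 < v \<bullet> (G *\<^sub>v v)"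
proof (cases "mat_inverse K")
  case None
  then have "K \<notin> Units (ring_mat TYPE(real) n ())" by (rule mat_inverse(1)[OF K])
  moreover have "det K \<noteq> 0" by (rule pos_def_det_nonzero[OF K pos])
  ultimately show ?thesis using det_non_zero_imp_unit[OF K, of "()"] by blast
next
  case (Some G)
  note G = mat_inverse(2)[OF K Some]
  have KG: "K *\<^sub>v (G *\<^sub>v v) = v" if "v \<in> carrier_vec n" for v
    using G K that by (simp add: assoc_mult_mat_vec[symmetric, of _ n n _ n])
  have "0 < v \<bullet> (G *\<^sub>v v)" if v: "v \<in> carrier_vec n" "v \<noteq> 0\<^sub>v n" for v
  proof -
    have Gv: "G *\<^sub>v v \<in> carrier_vec n" using G v by auto
    have "K *\<^sub>v 0\<^sub>v n = 0\<^sub>v n" using K by auto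
    then have "G *\<^sub>v v \<noteq> 0\<^sub>v n" using KG[OF v(1)] v(2) by metis
    from pos[OF Gv this] have "0 < (G *\<^sub>v v) \<bullet> v" by (simp add: KG v)
    then show ?thesis using comm_scalar_prod[OF Gv v(1)] by simp
  qed
  with that Some G KG show ?thesis by blast
qed

text \<open>In a homogeneous boundary condition \<open>c D x + K y = c t f\<close>, \<open>f \<bullet> y = 0\<close> with \<open>f\<close> the \<open>j\<close>-th
  unit vector, \<open>t\<close> plays the role of the free wall density.\<close>

definition flow_space :: "nat \<Rightarrow> nat \<Rightarrow> real mat \<Rightarrow> real mat \<Rightarrow> nat \<Rightarrow> real \<Rightarrow> real vec set" where
  "flow_space m n D K j c = {v \<in> carrier_vec (m + n). vec_last v n $ j = 0 \<and>
     (\<exists>t. \<forall>i<n. c * (D *\<^sub>v vec_first v m) $ i + (K *\<^sub>v vec_last v n) $ i = (if i = j then c * t else 0))}"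

lemma vec_first_linear:
  "v \<in> carrier_vec (m + n) \<Longrightarrow> w \<in> carrier_vec (m + n) \<Longrightarrow> vec_first (v + w) m = vec_first v m + vec_first w m"
  "v \<in> carrier_vec (m + n) \<Longrightarrow> vec_first (a \<cdot>\<^sub>v v) m = a \<cdot>\<^sub>v vec_first v m"
  by (auto simp: vec_first_def)

lemma vec_last_linear:
  "v \<in> carrier_vec (m + n) \<Longrightarrow> w \<in> carrier_vec (m + n) \<Longrightarrow> vec_last (v + w) n = vec_last v n + vec_last w n"
  "v \<in> carrier_vec (m + n) \<Longrightarrow> vec_last (a \<cdot>\<^sub>v v) n = a \<cdot>\<^sub>v vec_last v n"
  by (auto simp: vec_last_def)

lemma vec_first_last_append_vec [simp]:
  assumes "x \<in> carrier_vec m" "y \<in> carrier_vec n"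
  shows "vec_first (x @\<^sub>v y) m = x" "vec_last (x @\<^sub>v y) n = y"
  using assms by (auto simp: vec_first_def vec_last_def)

context
  fixes m n j :: nat and D K :: "real mat" and c :: real
  assumes D: "D \<in> carrier_mat n m" and K: "K \<in> carrier_mat n n" and j: "j < n"
    and pos: "\<And>y. y \<in> carrier_vec n \<Longrightarrow> y \<noteq> 0\<^sub>v n \<Longrightarrow> 0 < y \<bullet> (K *\<^sub>v y)"
begin

lemma flow_space_subspace:
  "VectorSpace.subspace class_ring (flow_space m n D K j c) (module_vec TYPE(real) (m + n))"
  unfolding VectorSpace.subspace_def submodule_def module_vec_simps
proof (intro conjI allI impI vec_vs vec_module)
  show "flow_space m n D K j c \<subseteq> carrier_vec (m + n)" by (auto simp: flow_space_def)
  show "0\<^sub>v (m + n) \<in> flow_space m n D K j c"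
  proof -
    have "vec_first (0\<^sub>v (m + n)) m = (0\<^sub>v m :: real vec)" "vec_last (0\<^sub>v (m + n)) n = (0\<^sub>v n :: real vec)"
      by (auto simp: vec_first_def vec_last_def)
    moreover have "D *\<^sub>v 0\<^sub>v m = 0\<^sub>v n" "K *\<^sub>v 0\<^sub>v n = 0\<^sub>v n" using D K by auto
    ultimately show ?thesis using j
      by (auto simp: flow_space_def simp del: index_mult_mat_vec intro!: exI[of _ 0])
  qed
next
  fix v w assume "v \<in> flow_space m n D K j c" "w \<in> flow_space m n D K j c"
  then obtain s t where v: "v \<in> carrier_vec (m + n)" "vec_last v n $ j = 0"
      "\<And>i. i < n \<Longrightarrow> c * (D *\<^sub>v vec_first v m) $ i + (K *\<^sub>v vec_last v n) $ i = (if i = j then c * s else 0)"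
    and w: "w \<in> carrier_vec (m + n)" "vec_last w n $ j = 0"
      "\<And>i. i < n \<Longrightarrow> c * (D *\<^sub>v vec_first w m) $ i + (K *\<^sub>v vec_last w n) $ i = (if i = j then c * t else 0)"
    by (auto simp: flow_space_def)
  have "c * (D *\<^sub>v vec_first (v + w) m) $ i + (K *\<^sub>v vec_last (v + w) n) $ i = (if i = j then c * (s + t) else 0)"
    if i: "i < n" for i
  proof -
    have "(D *\<^sub>v vec_first (v + w) m) $ i = (D *\<^sub>v vec_first v m) $ i + (D *\<^sub>v vec_first w m) $ i"
      "(K *\<^sub>v vec_last (v + w) n) $ i = (K *\<^sub>v vec_last v n) $ i + (K *\<^sub>v vec_last w n) $ i"
      using i D K v(1) w(1)
      by (simp_all only: vec_first_linear vec_last_linear mult_add_distrib_mat_vec[of _ n m]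
          mult_add_distrib_mat_vec[of _ n n] vec_first_carrier vec_last_carrier index_add_vec dim_mult_mat_vec carrier_matD)
    with v(3)[OF i] w(3)[OF i] show ?thesis by (simp add: algebra_simps split: if_splits)
  qed
  with v w j show "v + w \<in> flow_space m n D K j c"
    by (auto simp: flow_space_def vec_last_linear(1)[of v m n w])
next
  fix a :: real and v assume "v \<in> flow_space m n D K j c"
  then obtain s where v: "v \<in> carrier_vec (m + n)" "vec_last v n $ j = 0"
      "\<And>i. i < n \<Longrightarrow> c * (D *\<^sub>v vec_first v m) $ i + (K *\<^sub>v vec_last v n) $ i = (if i = j then c * s else 0)"
    by (auto simp: flow_space_def)
  have "c * (D *\<^sub>v vec_first (a \<cdot>\<^sub>v v) m) $ i + (K *\<^sub>v vec_last (a \<cdot>\<^sub>v v) n) $ i = (if i = j then c * (a * s) else 0)"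
    if i: "i < n" for i
  proof -
    have "(D *\<^sub>v vec_first (a \<cdot>\<^sub>v v) m) $ i = a * (D *\<^sub>v vec_first v m) $ i"
      "(K *\<^sub>v vec_last (a \<cdot>\<^sub>v v) n) $ i = a * (K *\<^sub>v vec_last v n) $ i"
      using i D K v(1)
      by (simp_all only: vec_first_linear vec_last_linear mult_mat_vec[of _ n m]
          mult_mat_vec[of _ n n] vec_first_carrier vec_last_carrier index_smult_vec dim_mult_mat_vec carrier_matD)
    moreover have "a * (c * (D *\<^sub>v vec_first v m) $ i + (K *\<^sub>v vec_last v n) $ i) = (if i = j then c * (a * s) else 0)"
      by (simp only: v(3)[OF i]) simp
    ultimately show ?thesis by (simp only: distrib_left mult.left_commute)
  qed
  with v j show "a \<cdot>\<^sub>v v \<in> flow_space m n D K j c"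
    by (auto simp: flow_space_def vec_last_linear(2)[of v m n])
qed

lemma flow_space_energy:
  assumes v: "v \<in> flow_space m n D K j c"
  shows "c * ((D *\<^sub>v vec_first v m) \<bullet> vec_last v n) = - (vec_last v n \<bullet> (K *\<^sub>v vec_last v n))"
proof -
  let ?x = "vec_first v m" and ?y = "vec_last v n"
  obtain t where y: "?y $ j = 0"
    and eq: "\<And>i. i < n \<Longrightarrow> c * (D *\<^sub>v ?x) $ i + (K *\<^sub>v ?y) $ i = (if i = j then c * t else 0)"
    using v by (auto simp: flow_space_def)
  have "c * ((D *\<^sub>v ?x) \<bullet> ?y) + ?y \<bullet> (K *\<^sub>v ?y) =
      (\<Sum>i<n. (c * (D *\<^sub>v ?x) $ i + (K *\<^sub>v ?y) $ i) * ?y $ i)"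
    using K unfolding scalar_prod_def
    by (simp add: sum_distrib_left sum.distrib algebra_simps atLeast0LessThan del: index_mult_mat_vec)
  also have "\<dots> = 0"
    by (rule sum.neutral) (use eq y in \<open>simp del: index_mult_mat_vec\<close>)
  finally show ?thesis by simp
qed

lemma flow_space_dissipative:
  assumes v: "v \<in> flow_space m n D K j c" and c: "0 \<le> c"
  shows "(D *\<^sub>v vec_first v m) \<bullet> vec_last v n \<le> 0"
proof (cases "vec_last v n = 0\<^sub>v n")
  case True
  then show ?thesis using D by simp
next
  case False
  then have "c * ((D *\<^sub>v vec_first v m) \<bullet> vec_last v n) < 0"
    using flow_space_energy[OF v] pos[of "vec_last v n"] by simp
  with c show ?thesis by (simp add: mult_less_0_iff)
qed

lemma flow_space_inj: "inj_on (\<lambda>v. vec_first v m) (flow_space m n D K j c)"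
proof (rule inj_onI)
  fix v w assume v: "v \<in> flow_space m n D K j c" and w: "w \<in> flow_space m n D K j c"
    and eq: "vec_first v m = vec_first w m"
  have vc: "v \<in> carrier_vec (m + n)" and wc: "w \<in> carrier_vec (m + n)"
    using v w by (auto simp: flow_space_def)
  interpret submodule class_ring "flow_space m n D K j c" "module_vec TYPE(real) (m + n)"
    using flow_space_subspace by (simp add: VectorSpace.subspace_def)
  define u where "u = v + (- 1) \<cdot>\<^sub>v w"
  have u: "u \<in> flow_space m n D K j c"
    using m_closed[OF v smult_closed[OF _ w, of "- 1"]] by (simp add: u_def module_vec_simps)
  have first: "vec_first u m = 0\<^sub>v m"
    unfolding u_def using vc wc eq by (simp add: vec_first_linear[of _ m n]) auto
  have "D *\<^sub>v 0\<^sub>v m = 0\<^sub>v n" using D by auto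
  then have "vec_last u n \<bullet> (K *\<^sub>v vec_last u n) = 0"
    using flow_space_energy[OF u] by (simp add: first)
  with pos[of "vec_last u n"] have last: "vec_last u n = 0\<^sub>v n" by force
  have "u = vec_first u m @\<^sub>v vec_last u n" using vc wc by (simp add: u_def)
  with first last have u0: "u = 0\<^sub>v (m + n)" by auto
  show "v = w"
  proof (rule eq_vecI)
    fix i assume "i < dim_vec w"
    with arg_cong[OF u0, of "\<lambda>u. u $ i"] vc wc show "v $ i = w $ i" by (simp add: u_def)
  qed (use vc wc in simp)
qed

lemma flow_space_surj: "(\<lambda>v. vec_first v m) ` flow_space m n D K j c = carrier_vec m"
proof (intro equalityI subsetI)
  fix x :: "real vec" assume x: "x \<in> carrier_vec m"
  obtain G where G: "G \<in> carrier_mat n n"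
    and KG: "\<And>v. v \<in> carrier_vec n \<Longrightarrow> K *\<^sub>v (G *\<^sub>v v) = v"
    and Gpos: "\<And>v. v \<in> carrier_vec n \<Longrightarrow> v \<noteq> 0\<^sub>v n \<Longrightarrow> 0 < v \<bullet> (G *\<^sub>v v)"
    using pos_def_mat_inverse[OF K pos] by metis
  define g where "g = G *\<^sub>v unit_vec n j"
  define h where "h = G *\<^sub>v (D *\<^sub>v x)"
  have g: "g \<in> carrier_vec n" and h: "h \<in> carrier_vec n" using G D x by (auto simp: g_def h_def intro!: mult_mat_vec_carrier)
  have "0 < g $ j"
    using Gpos[of "unit_vec n j"] g j by (simp add: g_def[symmetric] unit_vec_nonzero)
  define t where "t = h $ j / g $ j"
  define y where "y = c \<cdot>\<^sub>v (t \<cdot>\<^sub>v g - h)"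
  have y: "y \<in> carrier_vec n" "y $ j = 0"
    using g h j \<open>0 < g $ j\<close> by (auto simp: y_def t_def)
  have "K *\<^sub>v y = c \<cdot>\<^sub>v (t \<cdot>\<^sub>v (K *\<^sub>v g) - K *\<^sub>v h)"
    using K g h by (simp add: y_def mult_mat_vec[of _ n n] mult_minus_distrib_mat_vec[of _ n n])
  also have "K *\<^sub>v g = unit_vec n j" by (simp add: g_def KG)
  also have "K *\<^sub>v h = D *\<^sub>v x" unfolding h_def by (rule KG) (use D x in auto)
  finally have Ky: "K *\<^sub>v y = c \<cdot>\<^sub>v (t \<cdot>\<^sub>v unit_vec n j - D *\<^sub>v x)" .
  have "x @\<^sub>v y \<in> flow_space m n D K j c"
    unfolding flow_space_def
    using x y D j
    by (auto simp: Ky algebra_simps simp del: index_mult_mat_vec intro!: exI[of _ t])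
  then show "x \<in> (\<lambda>v. vec_first v m) ` flow_space m n D K j c"
    by (rule rev_image_eqI) (use x y in simp)
qed auto

lemma flow_space_dim: "subspace_dim (m + n) (flow_space m n D K j c) = m"
proof -
  let ?F = "flow_space m n D K j c"
  let ?V = "module_vec TYPE(real) (m + n)\<lparr>carrier := ?F\<rparr>"
  let ?W = "module_vec TYPE(real) m"
  let ?g = "inv_into ?F (\<lambda>v. vec_first v m)"
  interpret N: vec_space "TYPE(real)" "m + n" .
  interpret W: vec_space "TYPE(real)" m .
  interpret V: vectorspace class_ring ?V
    using N.subspace_is_vs[OF flow_space_subspace] by simp
  interpret sub: submodule class_ring ?F "module_vec TYPE(real) (m + n)"
    using flow_space_subspace by (simp add: VectorSpace.subspace_def)
  have sub: "?F \<subseteq> carrier_vec (m + n)" by (auto simp: flow_space_def)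
  have bij: "bij_betw (\<lambda>v. vec_first v m) ?F (carrier_vec m)"
    using flow_space_inj flow_space_surj by (simp add: bij_betw_def)
  have gF: "?g x \<in> ?F" and fg: "vec_first (?g x) m = x" if "x \<in> carrier_vec m" for x
    using that inv_into_into[of x "\<lambda>v. vec_first v m" ?F] f_inv_into_f[of x "\<lambda>v. vec_first v m" ?F]
    by (simp_all add: flow_space_surj)
  have gI: "?g x = v" if "v \<in> ?F" "vec_first v m = x" for x v
    using that inv_into_f_f[OF flow_space_inj] by blast
  interpret linear_map class_ring ?W ?V ?g
  proof (unfold_locales, unfold module_hom_def, simp add: module_vec_simps, intro conjI allI impI)
    show "?g \<in> carrier_vec m \<rightarrow> ?F" using gF by auto
  next
    fix x y :: "real vec" assume "x \<in> carrier_vec m \<and> y \<in> carrier_vec m"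
    then have xy: "x \<in> carrier_vec m" "y \<in> carrier_vec m" by auto
    show "?g (x + y) = ?g x + ?g y"
    proof (rule gI)
      show "?g x + ?g y \<in> ?F"
        using sub.m_closed[OF gF[OF xy(1)] gF[OF xy(2)]] by (simp add: module_vec_simps)
      show "vec_first (?g x + ?g y) m = x + y"
        using vec_first_linear(1)[of "?g x" m n "?g y"] gF[OF xy(1)] gF[OF xy(2)] sub fg xy by auto
    qed
  next
    fix a :: real and x :: "real vec" assume x: "x \<in> carrier_vec m"
    show "?g (a \<cdot>\<^sub>v x) = a \<cdot>\<^sub>v ?g x"
    proof (rule gI)
      show "a \<cdot>\<^sub>v ?g x \<in> ?F"
        using sub.smult_closed[OF _ gF[OF x], of a] by (simp add: module_vec_simps)
      show "vec_first (a \<cdot>\<^sub>v ?g x) m = a \<cdot>\<^sub>v x"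
        using vec_first_linear(2)[of "?g x" m n a] gF[OF x] sub fg x by auto
    qed
  qed
  have "W.dim = V.dim"
  proof (rule dim_eq)
    show "W.fin_dim" by (rule W.fin_dim)
    show "inj_on ?g (carrier ?W)"
      using bij_betw_inv_into[OF bij] by (simp add: bij_betw_def module_vec_simps)
    show "?g ` carrier ?W = carrier ?V"
      using bij_betw_inv_into[OF bij] by (simp add: bij_betw_def module_vec_simps)
  qed
  then show ?thesis by (simp add: subspace_dim_def W.dim_is_n)
qed

end

section \<open>The matrices of the moment system\<close>

lemma Mo_mat_carrier [simp]: "Mo_mat M \<in> carrier_mat (m_dim M) (n_dim M)"
  by (simp add: Mo_mat_def)

lemma Mo_mat_entry:
  assumes "i < m_dim M" "l < n_dim M" "even_list M ! i = (a1, a2, a3)" "odd_list M ! l = (b1, b2, b3)"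
  shows "Mo_mat M $$ (i, l) = (if a1 = b1 \<and> a3 = b3 then
      if a2 = Suc b2 then sqrt (real a2) else if b2 = Suc a2 then sqrt (real b2) else 0
     else 0)"
  using assms by (simp add: Mo_mat_def phi_xi2_integral)

lemma even_list_index:
  assumes "\<alpha> \<in> I_even M"
  obtains i where "i < m_dim M" "even_list M ! i = \<alpha>"
  using assms by (metis even_list_props(1) in_set_conv_nth length_index_lists(1))

lemma odd_list_index:
  assumes "\<alpha> \<in> I_odd M"
  obtains i where "i < n_dim M" "odd_list M ! i = \<alpha>"
  using assms by (metis odd_list_props(1) in_set_conv_nth length_index_lists(2))

text \<open>Row \<open>(b\<^sub>1, b\<^sub>2 - 1, b\<^sub>3)\<close> of the system expresses the component \<open>(b\<^sub>1, b\<^sub>2, b\<^sub>3)\<close> of the kernel vector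
  through the component \<open>(b\<^sub>1, b\<^sub>2 - 2, b\<^sub>3)\<close>.\<close>

lemma Mo_mat_inj:
  assumes y: "y \<in> carrier_vec (n_dim M)" and zero: "Mo_mat M *\<^sub>v y = 0\<^sub>v (m_dim M)"
  shows "y = 0\<^sub>v (n_dim M)"
proof -
  have "y $ l = 0" if "l < n_dim M" "odd_list M ! l = (b1, b2, b3)" for l b1 b2 b3
    using that
  proof (induction b2 arbitrary: l rule: less_induct)
    case (less b2)
    have "(b1, b2, b3) \<in> I_odd M"
      using less.prems odd_list_props(1)[of M] nth_mem[of l "odd_list M"] by (simp add: length_index_lists)
    then obtain a2 where a2: "b2 = Suc a2" "(b1, a2, b3) \<in> I_even M"
      by (cases b2) (auto simp: I_odd_def I_even_def)
    obtain i where i: "i < m_dim M" "even_list M ! i = (b1, a2, b3)"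
      using even_list_index[OF a2(2)] .
    have "Mo_mat M $$ (i, r) * y $ r = (if r = l then sqrt (real b2) * y $ l else 0)" if r: "r < n_dim M" for r
    proof -
      obtain c1 c2 c3 where c: "odd_list M ! r = (c1, c2, c3)" by (metis prod_cases3)
      have "r = l" if "odd_list M ! r = odd_list M ! l"
        using that r less.prems(1) odd_list_props(2)[of M] by (simp add: nth_eq_iff_index_eq length_index_lists)
      moreover have "y $ r = 0" if "c1 = b1" "c3 = b3" "a2 = Suc c2"
        using less.IH[of c2 r] that r c a2(1) by simp
      ultimately show ?thesis
        using Mo_mat_entry[OF i(1) r i(2) c] c less.prems(2) a2(1) by auto
    qed
    then have "(\<Sum>r<n_dim M. Mo_mat M $$ (i, r) * y $ r) = sqrt (real b2) * y $ l"
      using less.prems(1) by simp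
    moreover have "(\<Sum>r<n_dim M. Mo_mat M $$ (i, r) * y $ r) = 0"
      using arg_cong[OF zero, of "\<lambda>v. v $ i"] i(1) y carrier_matD[OF Mo_mat_carrier[of M]]
      by (simp add: scalar_prod_def atLeast0LessThan)
    ultimately show ?case using a2(1) by simp
  qed
  then show ?thesis using y by (metis carrier_vecD eq_vecI index_zero_vec prod_cases3)
qed

lemma uminus_A2_mat:
  "- A2_mat M = four_block_mat (0\<^sub>m (m_dim M) (m_dim M)) (- Mo_mat M)
     (transpose_mat (- Mo_mat M)) (0\<^sub>m (n_dim M) (n_dim M))"
  unfolding A2_mat_def by (rule eq_matI) (use carrier_matD[OF Mo_mat_carrier[of M]] in auto)

lemma num_nonneg_eigenvalues_uminus_A2_mat: "num_nonneg_eigenvalues (- A2_mat M) = m_dim M"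
  unfolding uminus_A2_mat
proof (rule num_nonneg_eigenvalues_bipartite)
  fix y assume y: "y \<in> carrier_vec (n_dim M)" and "- Mo_mat M *\<^sub>v y = 0\<^sub>v (m_dim M)"
  then have "Mo_mat M *\<^sub>v y = 0\<^sub>v (m_dim M)"
    using carrier_matD[OF Mo_mat_carrier[of M]]
    by (auto simp: vec_eq_iff)
  then show "y = 0\<^sub>v (n_dim M)" by (rule Mo_mat_inj[OF y])
qed simp

definition bc_gram :: "nat \<Rightarrow> real mat" where
  "bc_gram M = transpose_mat (Mo_mat M) * S_inv M * Mo_mat M"

lemma S_inv_pos_def:
  shows "S_inv M \<in> carrier_mat (m_dim M) (m_dim M)"
    and "\<And>v. v \<in> carrier_vec (m_dim M) \<Longrightarrow> v \<noteq> 0\<^sub>v (m_dim M) \<Longrightarrow> 0 < v \<bullet> (S_inv M *\<^sub>v v)"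
proof -
  obtain G where "mat_inverse (S_mat M) = Some G" "G \<in> carrier_mat (m_dim M) (m_dim M)"
    "\<And>v. v \<in> carrier_vec (m_dim M) \<Longrightarrow> v \<noteq> 0\<^sub>v (m_dim M) \<Longrightarrow> 0 < v \<bullet> (G *\<^sub>v v)"
    using pos_def_mat_inverse[OF S_mat_carrier S_mat_pos_def] by metis
  then show "S_inv M \<in> carrier_mat (m_dim M) (m_dim M)"
    and "\<And>v. v \<in> carrier_vec (m_dim M) \<Longrightarrow> v \<noteq> 0\<^sub>v (m_dim M) \<Longrightarrow> 0 < v \<bullet> (S_inv M *\<^sub>v v)"
    by (simp_all add: S_inv_def)
qed

lemma bc_gram_carrier: "bc_gram M \<in> carrier_mat (n_dim M) (n_dim M)"
  unfolding bc_gram_def by (rule mult_carrier_mat[OF mult_carrier_mat[OF _ S_inv_pos_def(1)] Mo_mat_carrier]) simp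

lemma bc_gram_pos_def:
  assumes y: "y \<in> carrier_vec (n_dim M)" "y \<noteq> 0\<^sub>v (n_dim M)"
  shows "0 < y \<bullet> (bc_gram M *\<^sub>v y)"
proof -
  let ?P = "Mo_mat M" and ?S = "S_inv M"
  note c = Mo_mat_carrier[of M] S_inv_pos_def(1)[of M]
  have Py: "?P *\<^sub>v y \<in> carrier_vec (m_dim M)" using c y by (metis mult_mat_vec_carrier)
  have SPy: "?S *\<^sub>v (?P *\<^sub>v y) \<in> carrier_vec (m_dim M)" using c Py by (metis mult_mat_vec_carrier)
  have T: "transpose_mat ?P \<in> carrier_mat (n_dim M) (m_dim M)" using c by simp
  have "bc_gram M *\<^sub>v y = transpose_mat ?P *\<^sub>v (?S *\<^sub>v (?P *\<^sub>v y))"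
    unfolding bc_gram_def
    using assoc_mult_mat_vec[OF mult_carrier_mat[OF T c(2)] c(1) y(1)] assoc_mult_mat_vec[OF T c(2) Py] by simp
  then have "y \<bullet> (bc_gram M *\<^sub>v y) = (transpose_mat ?P *\<^sub>v (?S *\<^sub>v (?P *\<^sub>v y))) \<bullet> y"
    using comm_scalar_prod[OF y(1) mult_mat_vec_carrier[OF T SPy]] by simp
  also have "\<dots> = (?S *\<^sub>v (?P *\<^sub>v y)) \<bullet> (?P *\<^sub>v y)"
    by (rule transpose_vec_mult_scalar[OF c(1) y(1) SPy])
  also have "\<dots> = (?P *\<^sub>v y) \<bullet> (?S *\<^sub>v (?P *\<^sub>v y))"
    by (rule comm_scalar_prod[OF SPy Py])
  also have "\<dots> > 0"
    using S_inv_pos_def(2)[OF Py] Mo_mat_inj[OF y(1)] y(2) by blast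
  finally show ?thesis .
qed

lemma bc_set_eq_flow_space:
  assumes j: "j < n_dim M" "odd_list M ! j = (0, 1, 0)"
  shows "bc_set M \<chi> (0, 0, 0) 0 =
    flow_space (m_dim M) (n_dim M) (transpose_mat (Mo_mat M)) (bc_gram M) j (chi_hat \<chi>)"
proof -
  let ?m = "m_dim M" and ?n = "n_dim M" and ?P = "Mo_mat M" and ?c = "chi_hat \<chi>"
  let ?T = "transpose_mat ?P"
  have T: "?T \<in> carrier_mat ?n ?m" by simp
  have len: "length (even_list M) = ?m" by (simp add: length_index_lists)
  obtain i0 where i0: "i0 < ?m" "even_list M ! i0 = (0, 0, 0)"
    using even_list_index[of "(0, 0, 0)" M] by (auto simp: I_even_def)
  have Te: "(?T *\<^sub>v unit_vec ?m i0) $ i = (if i = j then 1 else 0)" if i: "i < ?n" for i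
  proof -
    obtain b1 b2 b3 where b: "odd_list M ! i = (b1, b2, b3)" by (metis prod_cases3)
    have "i = j" if "odd_list M ! i = odd_list M ! j"
      using that i j(1) nth_eq_iff_index_eq[OF odd_list_props(2)[of M], of i j]
      by (simp add: length_index_lists)
    then have "Mo_mat M $$ (i0, i) = (if i = j then 1 else 0)"
      using Mo_mat_entry[OF i0(1) i i0(2) b] b j(2) by auto
    then show ?thesis using i i0(1) carrier_matD[OF Mo_mat_carrier[of M]] by simp
  qed
  have smult_mult: "(a \<cdot>\<^sub>m ?T) *\<^sub>v u = a \<cdot>\<^sub>v (?T *\<^sub>v u)" if u: "u \<in> carrier_vec ?m" for a u
  proof (rule eq_vecI)
    fix i assume "i < dim_vec (a \<cdot>\<^sub>v (?T *\<^sub>v u))"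
    then have "i < ?n" using carrier_matD[OF T] by simp
    moreover have "row ?T i \<in> carrier_vec ?m" using carrier_matD[OF T] by (metis row_carrier)
    ultimately show "((a \<cdot>\<^sub>m ?T) *\<^sub>v u) $ i = (a \<cdot>\<^sub>v (?T *\<^sub>v u)) $ i"
      using u carrier_matD[OF T] by (simp del: row_transpose)
  qed simp
  have index: "index_list M ! i = (0, 0, 0) \<longleftrightarrow> i = i0" if "i < N_dim M" for i
  proof -
    have "index_list M ! i0 = (0, 0, 0)" "i0 < N_dim M"
      using i0 by (simp_all add: index_list_def nth_append len N_dim_def)
    then show ?thesis
      using that nth_eq_iff_index_eq[OF distinct_index_list[of M], of i i0] by (simp add: length_index_lists)
  qed
  have wall: "wall_vec M \<rho> (0, 0, 0) 0 = (\<rho> \<cdot>\<^sub>v unit_vec ?m i0) @\<^sub>v 0\<^sub>v ?n" for \<rho>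
  proof (rule eq_vecI)
    fix i assume "i < dim_vec ((\<rho> \<cdot>\<^sub>v unit_vec ?m i0) @\<^sub>v 0\<^sub>v ?n)"
    then have i: "i < N_dim M" by (simp add: N_dim_def)
    have "wall_vec M \<rho> (0, 0, 0) 0 $ i = (if index_list M ! i = (0, 0, 0) then \<rho> else 0)"
      using i by (simp add: wall_vec_def)
    then show "wall_vec M \<rho> (0, 0, 0) 0 $ i = ((\<rho> \<cdot>\<^sub>v unit_vec ?m i0) @\<^sub>v 0\<^sub>v ?n) $ i"
      using i i0(1) by (auto simp: index N_dim_def)
  qed (simp add: wall_vec_def N_dim_def)
  have entry: "entry M v (0, 1, 0) = vec_last v ?n $ j" if v: "v \<in> carrier_vec (?m + ?n)" for v
  proof -
    have "index_list M ! (?m + j) = (0, 1, 0)" using j(2) by (simp add: index_list_def nth_append len)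
    then show ?thesis
      using entry_index_list[of "?m + j" M v] j(1) v by (simp add: N_dim_def vec_last_def)
  qed
  have bc: "bc_mat M \<chi> *\<^sub>v (v - wall_vec M \<rho> (0, 0, 0) 0) = 0\<^sub>v ?n \<longleftrightarrow>
      (\<forall>i<?n. ?c * (?T *\<^sub>v vec_first v ?m) $ i + (bc_gram M *\<^sub>v vec_last v ?n) $ i = (if i = j then ?c * \<rho> else 0))"
    if v: "v \<in> carrier_vec (?m + ?n)" for v \<rho>
  proof -
    let ?x = "vec_first v ?m" and ?y = "vec_last v ?n"
    let ?e = "\<rho> \<cdot>\<^sub>v unit_vec ?m i0"
    have "v - wall_vec M \<rho> (0, 0, 0) 0 = (?x - ?e) @\<^sub>v ?y"
      unfolding wall by (rule eq_vecI) (use v in \<open>auto simp: vec_first_def vec_last_def\<close>)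
    then have "bc_mat M \<chi> *\<^sub>v (v - wall_vec M \<rho> (0, 0, 0) 0) =
        ((?c \<cdot>\<^sub>m ?T) *\<^sub>v (?x - ?e) + bc_gram M *\<^sub>v ?y) @\<^sub>v (0\<^sub>m 0 ?m *\<^sub>v (?x - ?e) + 0\<^sub>m 0 ?n *\<^sub>v ?y)"
      unfolding bc_mat_def bc_gram_def[symmetric]
      by (simp only:) (rule four_block_mat_mult_vec, use bc_gram_carrier[of M] in auto)
    moreover have "((?c \<cdot>\<^sub>m ?T) *\<^sub>v (?x - ?e)) $ i =
        ?c * (?T *\<^sub>v ?x) $ i - (if i = j then ?c * \<rho> else 0)" if i: "i < ?n" for i
    proof -
      have "(?c \<cdot>\<^sub>m ?T) *\<^sub>v (?x - ?e) = ?c \<cdot>\<^sub>v (?T *\<^sub>v ?x - \<rho> \<cdot>\<^sub>v (?T *\<^sub>v unit_vec ?m i0))"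
        using T by (simp add: smult_mult mult_minus_distrib_mat_vec[OF T] mult_mat_vec[OF T])
      then show ?thesis
        using i Te[OF i] carrier_matD[OF Mo_mat_carrier[of M]]
        by (simp add: algebra_simps del: index_mult_mat_vec)
    qed
    ultimately have "bc_mat M \<chi> *\<^sub>v (v - wall_vec M \<rho> (0, 0, 0) 0) = 0\<^sub>v ?n \<longleftrightarrow>
        (\<forall>i<?n. ?c * (?T *\<^sub>v ?x) $ i - (if i = j then ?c * \<rho> else 0) + (bc_gram M *\<^sub>v ?y) $ i = 0)"
      using bc_gram_carrier[of M] by (simp add: vec_eq_iff del: index_mult_mat_vec)
    moreover have "p - r + q = 0 \<longleftrightarrow> p + q = r" for p q r :: real by auto
    ultimately show ?thesis by (simp only:)
  qed
  show ?thesis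
    unfolding bc_set_def flow_space_def N_dim_def
    by (rule Collect_cong, rule conj_cong[OF refl]) (simp only: entry bc)
qed

lemma A2_mat_quadratic_form:
  assumes v: "v \<in> carrier_vec (m_dim M + n_dim M)"
  shows "v \<bullet> (A2_mat M *\<^sub>v v) =
    2 * ((transpose_mat (Mo_mat M) *\<^sub>v vec_first v (m_dim M)) \<bullet> vec_last v (n_dim M))"
proof -
  let ?m = "m_dim M" and ?n = "n_dim M" and ?P = "Mo_mat M"
  let ?x = "vec_first v ?m" and ?y = "vec_last v ?n" and ?T = "transpose_mat ?P"
  have Py: "?P *\<^sub>v ?y \<in> carrier_vec ?m"
    by (rule mult_mat_vec_carrier[OF Mo_mat_carrier vec_last_carrier])
  have Tx: "?T *\<^sub>v ?x \<in> carrier_vec ?n"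
    by (rule mult_mat_vec_carrier[OF _ vec_first_carrier]) simp
  have "A2_mat M *\<^sub>v (?x @\<^sub>v ?y) = (0\<^sub>m ?m ?m *\<^sub>v ?x + ?P *\<^sub>v ?y) @\<^sub>v (?T *\<^sub>v ?x + 0\<^sub>m ?n ?n *\<^sub>v ?y)"
    unfolding A2_mat_def by (rule four_block_mat_mult_vec) auto
  also have "\<dots> = (?P *\<^sub>v ?y) @\<^sub>v (?T *\<^sub>v ?x)"
  proof -
    have "0\<^sub>m k k *\<^sub>v u = 0\<^sub>v k" if "u \<in> carrier_vec k" for k and u :: "real vec"
      by (rule eq_vecI) (use that in auto)
    then show ?thesis using Py Tx by simp
  qed
  finally have "(?x @\<^sub>v ?y) \<bullet> (A2_mat M *\<^sub>v (?x @\<^sub>v ?y)) = ?x \<bullet> (?P *\<^sub>v ?y) + ?y \<bullet> (?T *\<^sub>v ?x)"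
    using scalar_prod_append[OF vec_first_carrier vec_last_carrier Py Tx] by simp
  moreover have "?x \<bullet> (?P *\<^sub>v ?y) = (?T *\<^sub>v ?x) \<bullet> ?y"
    by (rule transpose_vec_mult_scalar[OF Mo_mat_carrier vec_last_carrier vec_first_carrier, symmetric])
  moreover have "?y \<bullet> (?T *\<^sub>v ?x) = (?T *\<^sub>v ?x) \<bullet> ?y"
    by (rule comm_scalar_prod[OF vec_last_carrier Tx])
  ultimately show ?thesis using v by simp
qed

theorem theorem4p1:
  fixes M :: nat and \<chi> :: real
  assumes "M \<ge> 1" and "0 \<le> \<chi>" and "\<chi> \<le> 1"
  shows "VectorSpace.subspace class_ring (bc_set M \<chi> (0, 0, 0) 0) (module_vec TYPE(real) (N_dim M)) \<and>
    subspace_dim (N_dim M) (bc_set M \<chi> (0, 0, 0) 0) = m_dim M \<and>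
    m_dim M = num_nonneg_eigenvalues (- A2_mat M) \<and>
    (\<forall>v \<in> bc_set M \<chi> (0, 0, 0) 0. - (v \<bullet> (A2_mat M *\<^sub>v v)) \<ge> 0)"
proof -
  obtain j where j: "j < n_dim M" "odd_list M ! j = (0, 1, 0)"
    using odd_list_index[of "(0, 1, 0)" M] assms(1) by (auto simp: I_odd_def)
  have T: "transpose_mat (Mo_mat M) \<in> carrier_mat (n_dim M) (m_dim M)" by simp
  have c: "0 \<le> chi_hat \<chi>" using assms(2,3) by (simp add: chi_hat_def)
  note flow = T bc_gram_carrier j(1) bc_gram_pos_def
  have "0 \<le> - (v \<bullet> (A2_mat M *\<^sub>v v))" if "v \<in> bc_set M \<chi> (0, 0, 0) 0" for v
    using that flow_space_dissipative[OF flow _ c, of v]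
    by (simp add: A2_mat_quadratic_form bc_set_eq_flow_space[OF j] flow_space_def)
  then show ?thesis
    using flow_space_subspace[OF flow] flow_space_dim[OF flow]
    by (simp add: bc_set_eq_flow_space[OF j] N_dim_def num_nonneg_eigenvalues_uminus_A2_mat)
qed

end
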